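(* Let $R$ be a finite Frobenius ring and let $C\leq {}_RR^n$ be a modular two-weight code with nonzero homogeneous weights $w_1<w_2$. Then the graph $\Gamma(C)$ is strongly regular with parameters $(N,K,\lambda,\mu)$ given by $$N=\frac{|C|}{|C_0|},\qquad K=\frac{(w_2-n)N-w_2}{w_2-w_1},$$ $$\lambda=\frac{K\left(\frac{w_1^2}{n}-2w_1\right)+w_2(K-1)}{w_2-w_1},\qquad \mu=\frac{K\left(\frac{w_1w_2}{n}-w_1-w_2\right)+w_2K}{w_2-w_1}.$$ Moreover, the graph $\Gamma(C)$ is trivial if and only if $w_1=n$.
   Context: A finite ring $R$ (with $1$, unit group $R^\times$) is a Frobenius ring if there is a character $\chi\in\mathrm{Hom}_{\mathbb{Z}}(R,\mathbb{C}^\times)$ of $(R,+)$ whose kernel contains no nonzero left (or right) ideal of $R$. The (normalized) homogeneous weight is $w_{\mathrm{hom}}(x)=1-\frac{1}{|R^\times|}\sum_{u\in R^\times}\chi(ux)$ for $x\in R$ (independent of the choice of $\chi$; it takes real values $\ge 0$), extended to $R^n$ by $w_{\mathrm{hom}}(\mathbf{x})=\sum_{j=1}^n w_{\mathrm{hom}}(x_j)$. A (left) linear code $C\leq{}_RR^n$ is a submodule of the left module ${}_RR^n$. Points of the projective geometry $\mathrm{PG}(R^k_R)$ are the nonzero cyclic submodules $\mathbf{g}R$ of the free right module $R^k_R$ (column vectors). If $C$ has no all-zero coordinate and $C=\{\mathbf{x}\mathbf{G};\mathbf{x}\in R^k\}$ with $\mathbf{G}=(\mathbf{g}_1|\dots|\mathbf{g}_n)\in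 R^{k\times n}$, put $\alpha_C(\mathbf{g}R)=|\{j;1\le j\le n,\ \mathbf{g}_jR=\mathbf{g}R\}|$ for every point $\mathbf{g}R$. Such a code $C$ is modular of index $r$ if $r\in\mathbb{Q}$ and for every point $\mathbf{g}R$ either $\alpha_C(\mathbf{g}R)=0$ or $\alpha_C(\mathbf{g}R)=r\,|\mathbf{g}R^\times|$; $C$ is modular if it is modular of some index. (This does not depend on the choice of $k$ and $\mathbf{G}$.) A two-weight code is a linear code $C$ whose codewords take exactly two distinct nonzero homogeneous weights $w_1<w_2$. Put $w_0=0$ and $C_i=\{\mathbf{c}\in C;w_{\mathrm{hom}}(\mathbf{c})=w_i\}$ for $i=0,1,2$. The set $C_0$ is a subgroup of $(C,+)$, and $C_1$, $C_2$ are unions of cosets of $C_0$. $\Gamma(C)$ is the graph whose vertices are the cosets of $C_0$ in $C$, with $\mathbf{c}+C_0$ and $\mathbf{d}+C_0$ adjacent iff $w_{\mathrm{hom}}(\mathbf{c}-\mathbf{d})=w_1$ (i.e. the Cayley graph of $C/C_0$ with respect to $C_1/C_0$). A simple graph is strongly regular with parameters $(N,K,\lambda,\mu)$ if it has $N$ vertices, is regular of degree $K$, and any two adjacent (resp. distinct nonadjacent) vertices have exactly $\lambda$ (resp. $\mu$) common neighbours. A strongly regular graph is called trivial if it or its complement is a disjoint union of cliques of the same size (equivalently, $\mu=0$ resp. $\mu=K$). *)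

theory Defs
  imports Complex_Main "HOL-Library.Disjoint_Sets"
    "Jordan_Normal_Form.Matrix" "Graph_Theory.Pair_Digraph"
begin

text \<open>
  Finite, not necessarily commutative rings with one are types of the sort \<open>{ring_1, finite}\<close>.
\<close>

section \<open>Frobenius rings and the homogeneous weight\<close>

definition left_ideal :: "'a::ring_1 set \<Rightarrow> bool" where
  "left_ideal I \<longleftrightarrow>
     0 \<in> I \<and> (\<forall>x\<in>I. \<forall>y\<in>I. x + y \<in> I) \<and> (\<forall>r. \<forall>x\<in>I. r * x \<in> I)"

definition right_ideal :: "'a::ring_1 set \<Rightarrow> bool" where
  "right_ideal I \<longleftrightarrow>
     0 \<in> I \<and> (\<forall>x\<in>I. \<forall>y\<in>I. x + y \<in> I) \<and> (\<forall>r. \<forall>x\<in>I. x * r \<in> I)"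

definition additive_char :: "('a::ring_1 \<Rightarrow> complex) \<Rightarrow> bool" where
  "additive_char \<chi> \<longleftrightarrow> (\<forall>x. \<chi> x \<noteq> 0) \<and> (\<forall>x y. \<chi> (x + y) = \<chi> x * \<chi> y)"

definition char_ker :: "('a::ring_1 \<Rightarrow> complex) \<Rightarrow> 'a set" where
  "char_ker \<chi> = {x. \<chi> x = 1}"

text \<open>
  For a finite ring the left and the right condition are equivalent, so the disjunction
  describes the same characters as either of them.
\<close>

definition generating_char :: "('a::ring_1 \<Rightarrow> complex) \<Rightarrow> bool" where
  "generating_char \<chi> \<longleftrightarrow> additive_char \<chi> \<and>
     ((\<forall>I. left_ideal I \<and> I \<subseteq> char_ker \<chi> \<longrightarrow> I = {0}) \<or>
      (\<forall>I. right_ideal I \<and> I \<subseteq> char_ker \<chi> \<longrightarrow> I = {0}))"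

definition frobenius_ring :: "'a::{ring_1, finite} itself \<Rightarrow> bool" where
  "frobenius_ring _ \<longleftrightarrow> (\<exists>\<chi> :: 'a \<Rightarrow> complex. generating_char \<chi>)"

definition ring_units :: "'a::ring_1 set" where
  "ring_units = {u. \<exists>v. u * v = 1 \<and> v * u = 1}"

text \<open>
  The character sum is real (see \<open>hom_weight_eq\<close> below), so taking real parts loses nothing.
\<close>

definition hom_weight :: "('a::{ring_1, finite} \<Rightarrow> complex) \<Rightarrow> 'a \<Rightarrow> real" where
  "hom_weight \<chi> x = 1 - Re (\<Sum>u\<in>ring_units. \<chi> (u * x)) / real (card (ring_units :: 'a set))"

definition hom_weight_vec :: "('a::{ring_1, finite} \<Rightarrow> complex) \<Rightarrow> 'a vec \<Rightarrow> real" where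
  "hom_weight_vec \<chi> x = (\<Sum>j<dim_vec x. hom_weight \<chi> (x $ j))"

lemma additive_char_zero: "additive_char \<chi> \<Longrightarrow> \<chi> 0 = 1"
  unfolding additive_char_def by (metis add_0 mult_cancel_right1)

lemma additive_char_uminus:
  assumes "additive_char \<chi>"
  shows "\<chi> (- x) = inverse (\<chi> x)"
proof -
  have "\<chi> x * \<chi> (- x) = 1"
    using assms additive_char_zero[OF assms] unfolding additive_char_def
    by (metis add.right_inverse)
  then show ?thesis
    by (metis inverse_unique)
qed

lemma additive_char_norm:
  fixes \<chi> :: "'a::{ring_1, finite} \<Rightarrow> complex"
  assumes "additive_char \<chi>"
  shows "norm (\<chi> x) = 1"
proof -
  let ?S = "range (\<lambda>x. norm (\<chi> x))"
  have "Max ?S \<in> ?S" by (rule Max_in) auto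
  then obtain z where z: "Max ?S = norm (\<chi> z)" by blast
  have le: "norm (\<chi> y) \<le> norm (\<chi> z)" for y
    unfolding z[symmetric] by (rule Max_ge) auto
  have pos: "norm (\<chi> z) > 0"
    using assms unfolding additive_char_def by simp
  have "norm (\<chi> (z + z)) = norm (\<chi> z) * norm (\<chi> z)"
    using assms unfolding additive_char_def by (simp add: norm_mult)
  then have "norm (\<chi> z) * norm (\<chi> z) \<le> 1 * norm (\<chi> z)"
    using le[of "z + z"] by simp
  then have "norm (\<chi> z) \<le> 1"
    using pos by (rule mult_right_le_imp_le)
  then have le1: "norm (\<chi> y) \<le> 1" for y
    using le[of y] by linarith
  have "inverse (norm (\<chi> x)) \<le> 1"
    using le1[of "- x"] additive_char_uminus[OF assms, of x] by (simp add: norm_inverse)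
  moreover have "norm (\<chi> x) > 0"
    using assms unfolding additive_char_def by simp
  ultimately show ?thesis
    using le1[of x] by (simp add: field_simps)
qed

lemma hom_weight_eq:
  fixes \<chi> :: "'a::{ring_1, finite} \<Rightarrow> complex"
  assumes "additive_char \<chi>"
  shows "complex_of_real (hom_weight \<chi> x)
    = 1 - (\<Sum>u\<in>ring_units. \<chi> (u * x)) / of_nat (card (ring_units :: 'a set))"
proof -
  let ?s = "\<Sum>u\<in>ring_units. \<chi> (u * x)"
  have cnj: "cnj (\<chi> y) = \<chi> (- y)" for y
    using additive_char_norm[OF assms, of y] additive_char_uminus[OF assms, of y]
    by (simp add: divide_conv_cnj inverse_eq_divide)
  have units: "- u \<in> ring_units" if "u \<in> ring_units" for u :: 'a
  proof -
    from that obtain v where "u * v = 1" "v * u = 1"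
      unfolding ring_units_def by blast
    then have "(- u) * (- v) = 1 \<and> (- v) * (- u) = 1"
      by simp
    then show ?thesis
      unfolding ring_units_def by blast
  qed
  have bij: "bij_betw uminus (ring_units :: 'a set) ring_units"
    by (rule bij_betwI[where g = uminus]) (simp_all add: units)
  have "cnj ?s = (\<Sum>u\<in>ring_units. \<chi> (- u * x))"
    by (simp add: cnj)
  also have "\<dots> = ?s"
    by (rule sum.reindex_bij_betw[OF bij])
  finally have "cnj ?s = ?s" .
  then have "?s = complex_of_real (Re ?s)"
    by (metis Reals_cnj_iff of_real_Re)
  then show ?thesis
    unfolding hom_weight_def by (metis of_real_1 of_real_diff of_real_divide of_real_of_nat_eq)
qed

lemma hom_weight_nonneg:
  fixes \<chi> :: "'a::{ring_1, finite} \<Rightarrow> complex"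
  assumes "additive_char \<chi>"
  shows "hom_weight \<chi> x \<ge> 0"
proof -
  have "(1::'a) \<in> ring_units" by (auto simp: ring_units_def)
  then have pos: "card (ring_units :: 'a set) > 0" by (auto simp: card_gt_0_iff)
  have "Re (\<Sum>u\<in>ring_units. \<chi> (u * x)) \<le> (\<Sum>u\<in>(ring_units :: 'a set). 1)"
    unfolding Re_sum
    by (rule sum_mono) (metis additive_char_norm[OF assms] complex_Re_le_cmod)
  then show ?thesis
    using pos by (simp add: hom_weight_def field_simps)
qed

section \<open>Linear codes and modularity\<close>

definition left_linear_code :: "nat \<Rightarrow> 'a::ring_1 vec set \<Rightarrow> bool" where
  "left_linear_code n C \<longleftrightarrow> C \<subseteq> carrier_vec n \<and> 0\<^sub>v n \<in> C \<and>
     (\<forall>x\<in>C. \<forall>y\<in>C. x + y \<in> C) \<and> (\<forall>r. \<forall>x\<in>C. r \<cdot>\<^sub>v x \<in> C)"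

definition no_zero_coordinate :: "nat \<Rightarrow> 'a::ring_1 vec set \<Rightarrow> bool" where
  "no_zero_coordinate n C \<longleftrightarrow> (\<forall>j<n. \<exists>x\<in>C. x $ j \<noteq> 0)"

text \<open>
  The \<open>j\<close>-th entry of \<open>xG\<close> is \<open>\<Sum>i. x\<^sub>i G\<^sub>i\<^sub>j\<close>, with the entries of \<open>x\<close> as left factors;
  the order matters since the ring need not be commutative.
\<close>

definition row_times_mat :: "'a::ring_1 vec \<Rightarrow> 'a mat \<Rightarrow> 'a vec" where
  "row_times_mat x G = vec (dim_col G) (\<lambda>j. x \<bullet> col G j)"

definition generates_code :: "nat \<Rightarrow> nat \<Rightarrow> 'a::ring_1 mat \<Rightarrow> 'a vec set \<Rightarrow> bool" where
  "generates_code k n G C \<longleftrightarrow>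
     G \<in> carrier_mat k n \<and> C = {row_times_mat x G | x. x \<in> carrier_vec k}"

definition right_smult_vec :: "'a::ring_1 vec \<Rightarrow> 'a \<Rightarrow> 'a vec" where
  "right_smult_vec g r = map_vec (\<lambda>a. a * r) g"

definition cyclic_submodule :: "'a::ring_1 vec \<Rightarrow> 'a vec set" where
  "cyclic_submodule g = {right_smult_vec g r | r. True}"

definition unit_orbit :: "'a::ring_1 vec \<Rightarrow> 'a vec set" where
  "unit_orbit g = {right_smult_vec g u | u. u \<in> ring_units}"

definition point_mult :: "'a::ring_1 mat \<Rightarrow> 'a vec set \<Rightarrow> nat" where
  "point_mult G P = card {j. j < dim_col G \<and> cyclic_submodule (col G j) = P}"

text \<open>
  The condition does not depend on the choice of \<open>k\<close> and \<open>G\<close>, so it is required for some generator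
  matrix only. The points are the submodules \<open>gR\<close> with \<open>g \<noteq> 0\<close>.
\<close>

definition modular_of_index :: "nat \<Rightarrow> 'a::ring_1 vec set \<Rightarrow> rat \<Rightarrow> bool" where
  "modular_of_index n C r \<longleftrightarrow> no_zero_coordinate n C \<and>
     (\<exists>k G. generates_code k n G C \<and>
        (\<forall>g \<in> carrier_vec k. g \<noteq> 0\<^sub>v k \<longrightarrow>
           point_mult G (cyclic_submodule g) = 0 \<or>
           of_nat (point_mult G (cyclic_submodule g)) = r * of_nat (card (unit_orbit g))))"

definition modular_code :: "nat \<Rightarrow> 'a::ring_1 vec set \<Rightarrow> bool" where
  "modular_code n C \<longleftrightarrow> (\<exists>r. modular_of_index n C r)"

section \<open>Two-weight codes and their graphs\<close>

definition two_weight_code ::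
    "('a::{ring_1, finite} \<Rightarrow> complex) \<Rightarrow> nat \<Rightarrow> 'a vec set \<Rightarrow> real \<Rightarrow> real \<Rightarrow> bool" where
  "two_weight_code \<chi> n C w1 w2 \<longleftrightarrow> left_linear_code n C \<and>
     w1 < w2 \<and> hom_weight_vec \<chi> ` C - {0} = {w1, w2}"

definition weight_zero_subcode ::
    "('a::{ring_1, finite} \<Rightarrow> complex) \<Rightarrow> 'a vec set \<Rightarrow> 'a vec set" where
  "weight_zero_subcode \<chi> C = {c \<in> C. hom_weight_vec \<chi> c = 0}"

definition code_coset ::
    "('a::{ring_1, finite} \<Rightarrow> complex) \<Rightarrow> 'a vec set \<Rightarrow> 'a vec \<Rightarrow> 'a vec set" where
  "code_coset \<chi> C c = (\<lambda>x. c + x) ` weight_zero_subcode \<chi> C"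

text \<open>
  The weight is constant on the cosets of the weight-zero subcode, so adjacency does not depend on
  the representatives \<open>c\<close> and \<open>d\<close>.
\<close>

definition code_graph ::
    "('a::{ring_1, finite} \<Rightarrow> complex) \<Rightarrow> 'a vec set \<Rightarrow> real \<Rightarrow> 'a vec set pair_pre_digraph" where
  "code_graph \<chi> C w1 =
     \<lparr> pverts = code_coset \<chi> C ` C,
       parcs = {(code_coset \<chi> C c, code_coset \<chi> C d) | c d.
                  c \<in> C \<and> d \<in> C \<and> hom_weight_vec \<chi> (c - d) = w1} \<rparr>"

section \<open>Strongly regular graphs\<close>

text \<open>
  As in the graph library, a simple graph is a finite loop-free digraph with symmetric arc
  relation.
\<close>

definition neighbours :: "'v pair_pre_digraph \<Rightarrow> 'v \<Rightarrow> 'v set" where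
  "neighbours G v = {u \<in> pverts G. (v, u) \<in> parcs G}"

definition strongly_regular ::
    "'v pair_pre_digraph \<Rightarrow> nat \<Rightarrow> nat \<Rightarrow> nat \<Rightarrow> nat \<Rightarrow> bool" where
  "strongly_regular G N K l m \<longleftrightarrow> pair_graph G \<and> card (pverts G) = N \<and>
     (\<forall>v \<in> pverts G. card (neighbours G v) = K) \<and>
     (\<forall>u \<in> pverts G. \<forall>v \<in> pverts G. (u, v) \<in> parcs G \<longrightarrow>
        card (neighbours G u \<inter> neighbours G v) = l) \<and>
     (\<forall>u \<in> pverts G. \<forall>v \<in> pverts G. u \<noteq> v \<and> (u, v) \<notin> parcs G \<longrightarrow>
        card (neighbours G u \<inter> neighbours G v) = m)"

definition graph_complement :: "'v pair_pre_digraph \<Rightarrow> 'v pair_pre_digraph" where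
  "graph_complement G =
     \<lparr> pverts = pverts G,
       parcs = {(u, v). u \<in> pverts G \<and> v \<in> pverts G \<and> u \<noteq> v \<and> (u, v) \<notin> parcs G} \<rparr>"

definition disjoint_union_of_equal_cliques :: "'v pair_pre_digraph \<Rightarrow> bool" where
  "disjoint_union_of_equal_cliques G \<longleftrightarrow>
     (\<exists>P s. partition_on (pverts G) P \<and> (\<forall>X\<in>P. card X = s) \<and>
        parcs G = {(u, v). u \<noteq> v \<and> (\<exists>X\<in>P. u \<in> X \<and> v \<in> X)})"

definition trivial_srg :: "'v pair_pre_digraph \<Rightarrow> bool" where
  "trivial_srg G \<longleftrightarrow> disjoint_union_of_equal_cliques G \<or>
     disjoint_union_of_equal_cliques (graph_complement G)"

end

theory Submission
  imports Defs
begin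

text \<open>
  Put \<open>F = n - w\<^sub>h\<^sub>o\<^sub>m\<close> on \<open>C\<close>. As the Nakayama automorphism permutes the units, \<open>F\<close> is the
  average over the units \<open>u\<close> of the character sums \<open>\<Sum>j. \<chi> (c\<^sub>j u)\<close>, that is, a sum of
  characters \<open>c \<mapsto> \<chi> (x \<bullet> g\<^sub>j u)\<close> for \<open>c = xG\<close>. Two generators of a cyclic module over a finite ring
  differ by a unit, so modularity says that all these characters occur equally often. By
  orthogonality, \<open>F * F\<close> is then a multiple of \<open>F\<close>, while \<open>F\<close> sums to zero and is constant on the
  cosets of \<open>C\<^sub>0\<close>. The indicator function of \<open>C\<^sub>1\<close> is a linear combination of \<open>1\<close>, \<open>F\<close> and the
  indicator function of \<open>C\<^sub>0\<close>, so its convolution square takes only one value on each \<open>C\<^sub>i\<close>.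
  Finally \<open>K > 0\<close> forces \<open>w\<^sub>2 > n\<close>, hence \<open>\<mu> \<noteq> 0\<close>, and \<open>\<mu> = K\<close> amounts to \<open>w\<^sub>1 = n\<close>.
\<close>

section \<open>Generating characters\<close>

text \<open>Applying \<open>p\<close> multiplies the sum by \<open>z\<close>, which differs from 1.
  A permutation of a set is used instead of a group translation so that the lemma also serves the
  code, whose vector type is not a group type.\<close>

lemma sum_eq_zero_by_translation:
  fixes \<psi> :: "'b \<Rightarrow> complex"
  assumes "bij_betw p A A" and "\<And>x. x \<in> A \<Longrightarrow> \<psi> (p x) = z * \<psi> x" and "z \<noteq> 1"
  shows "sum \<psi> A = 0"
proof -
  have "sum \<psi> A = (\<Sum>x\<in>A. \<psi> (p x))"
    by (rule sum.reindex_bij_betw[OF assms(1), symmetric])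
  also have "\<dots> = z * sum \<psi> A"
    using assms(2) by (simp add: sum_distrib_left)
  finally show ?thesis
    using assms(3) by (metis mult_cancel_right1)
qed

lemma sum_hom_UNIV:
  fixes \<psi> :: "'a::{ab_group_add, finite} \<Rightarrow> complex"
  assumes add: "\<And>x y. \<psi> (x + y) = \<psi> x * \<psi> y"
  shows "sum \<psi> UNIV = (if \<forall>x. \<psi> x = 1 then of_nat (card (UNIV :: 'a set)) else 0)"
proof (cases "\<forall>x. \<psi> x = 1")
  case False
  then obtain a where "\<psi> a \<noteq> 1" by blast
  moreover have "bij_betw ((+) a) UNIV UNIV"
    by (rule bij_betwI[where g = "\<lambda>x. x - a"]) auto
  ultimately show ?thesis
    using sum_eq_zero_by_translation[of "(+) a" UNIV \<psi> "\<psi> a"] add False by auto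
qed simp

text \<open>
  Summing \<open>B\<close> over all pairs shows that both radicals of a pairing have the same size.
\<close>

lemma pairing_nondegenerate_swap:
  fixes B :: "'a::{ab_group_add, finite} \<Rightarrow> 'a \<Rightarrow> complex"
  assumes addl: "\<And>x y z. B (x + y) z = B x z * B y z"
    and addr: "\<And>x y z. B x (y + z) = B x y * B x z"
    and nz: "\<And>x y. B x y \<noteq> 0"
    and nondeg: "\<And>y. (\<And>x. B x y = 1) \<Longrightarrow> y = 0"
    and x: "\<And>y. B x y = 1"
  shows "x = 0"
proof -
  let ?A = "{x. \<forall>y. B x y = 1}"
  have B0: "B 0 y = 1" "B y 0 = 1" for y
    using addl[of 0 0 y] addr[of y 0 0] nz[of 0 y] nz[of y 0] by simp_all
  have 1: "(\<Sum>x\<in>UNIV. B x y) = (if y = 0 then of_nat (card (UNIV :: 'a set)) else 0)" for y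
  proof -
    have "(\<forall>x. B x y = 1) \<longleftrightarrow> y = 0"
      using nondeg B0 by blast
    then show ?thesis
      using sum_hom_UNIV[of "\<lambda>x. B x y", OF addl] by simp
  qed
  have 2: "(\<Sum>y\<in>UNIV. B x y) = (if x \<in> ?A then of_nat (card (UNIV :: 'a set)) else 0)" for x
    using sum_hom_UNIV[of "B x", OF addr] by simp
  have "(\<Sum>x\<in>UNIV. \<Sum>y\<in>UNIV. B x y) = (\<Sum>y\<in>UNIV. \<Sum>x\<in>UNIV. B x y)"
    by (rule sum.swap)
  then have "of_nat (card ?A) * of_nat (card (UNIV :: 'a set)) = (of_nat (card (UNIV :: 'a set)) :: complex)"
    unfolding 1 2 by (simp add: sum.If_cases)
  then have "card ?A = 1"
    by simp
  then obtain z where "?A = {z}"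
    by (rule card_1_singletonE)
  moreover have "x \<in> ?A" "0 \<in> ?A"
    using x B0 by blast+
  ultimately show ?thesis
    by (metis singletonD)
qed

text \<open>The definition gives the ideal condition on one side only. On that side an
  \<open>r\<close> in the radical of the pairing \<open>\<chi> (x * y)\<close> generates a principal
  ideal inside the kernel, so \<open>r = 0\<close>. Finiteness transfers nondegeneracy to the other
  side by \<open>pairing_nondegenerate_swap\<close>.\<close>

lemma generating_char_nondegenerate:
  fixes \<chi> :: "'a::{ring_1, finite} \<Rightarrow> complex"
  assumes "generating_char \<chi>"
  shows "(\<And>x. \<chi> (x * r) = 1) \<Longrightarrow> r = 0" and "(\<And>x. \<chi> (r * x) = 1) \<Longrightarrow> r = 0"
proof -
  have add: "\<chi> (x + y) = \<chi> x * \<chi> y" and nz: "\<chi> x \<noteq> 0" for x y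
    using assms unfolding generating_char_def additive_char_def by auto
  have l: "left_ideal (range (\<lambda>x. x * r))" for r :: 'a
    unfolding left_ideal_def
  proof (intro conjI allI ballI)
    show "0 \<in> range (\<lambda>x. x * r)" by (rule range_eqI[of _ _ 0]) simp
    fix x y s assume "x \<in> range (\<lambda>x. x * r)" "y \<in> range (\<lambda>x. x * r)"
    then obtain a b where ab: "x = a * r" "y = b * r" by blast
    show "x + y \<in> range (\<lambda>x. x * r)"
      by (rule range_eqI[of _ _ "a + b"]) (simp add: ab distrib_right)
    show "s * x \<in> range (\<lambda>x. x * r)"
      by (rule range_eqI[of _ _ "s * a"]) (simp add: ab mult.assoc)
  qed
  have r: "right_ideal (range (\<lambda>x. r * x))" for r :: 'a
    unfolding right_ideal_def
  proof (intro conjI allI ballI)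
    show "0 \<in> range (\<lambda>x. r * x)" by (rule range_eqI[of _ _ 0]) simp
    fix x y s assume "x \<in> range (\<lambda>x. r * x)" "y \<in> range (\<lambda>x. r * x)"
    then obtain a b where ab: "x = r * a" "y = r * b" by blast
    show "x + y \<in> range (\<lambda>x. r * x)"
      by (rule range_eqI[of _ _ "a + b"]) (simp add: ab distrib_left)
    show "x * s \<in> range (\<lambda>x. r * x)"
      by (rule range_eqI[of _ _ "a * s"]) (simp add: ab mult.assoc)
  qed
  have "(\<forall>r. (\<forall>x. \<chi> (x * r) = 1) \<longrightarrow> r = 0) \<or> (\<forall>r. (\<forall>x. \<chi> (r * x) = 1) \<longrightarrow> r = 0)"
  proof -
    have "r = 0" if "\<forall>I. left_ideal I \<and> I \<subseteq> char_ker \<chi> \<longrightarrow> I = {0}" "\<forall>x. \<chi> (x * r) = 1" for r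
    proof -
      have "range (\<lambda>x. x * r) = {0}"
        using that l[of r] by (auto simp: char_ker_def)
      then show ?thesis by (metis mult_1 rangeI singletonD)
    qed
    moreover have "r = 0" if "\<forall>I. right_ideal I \<and> I \<subseteq> char_ker \<chi> \<longrightarrow> I = {0}" "\<forall>x. \<chi> (r * x) = 1" for r
    proof -
      have "range (\<lambda>x. r * x) = {0}"
        using that r[of r] by (auto simp: char_ker_def)
      then show ?thesis by (metis mult_1_right rangeI singletonD)
    qed
    ultimately show ?thesis
      using assms unfolding generating_char_def by blast
  qed
  moreover have "(\<forall>r. (\<forall>x. \<chi> (x * r) = 1) \<longrightarrow> r = 0) \<longleftrightarrow> (\<forall>r. (\<forall>x. \<chi> (r * x) = 1) \<longrightarrow> r = 0)"
  proof (intro iffI allI impI)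
    fix r assume "\<forall>r. (\<forall>x. \<chi> (x * r) = 1) \<longrightarrow> r = 0" "\<forall>x. \<chi> (r * x) = 1"
    then show "r = 0"
      by (intro pairing_nondegenerate_swap[of "\<lambda>x y. \<chi> (x * y)" r])
        (simp_all add: distrib_left distrib_right add nz)
  next
    fix r assume "\<forall>r. (\<forall>x. \<chi> (r * x) = 1) \<longrightarrow> r = 0" "\<forall>x. \<chi> (x * r) = 1"
    then show "r = 0"
      by (intro pairing_nondegenerate_swap[of "\<lambda>x y. \<chi> (y * x)" r])
        (simp_all add: distrib_left distrib_right add nz)
  qed
  ultimately have "\<forall>r. (\<forall>x. \<chi> (x * r) = 1) \<longrightarrow> r = 0" "\<forall>r. (\<forall>x. \<chi> (r * x) = 1) \<longrightarrow> r = 0"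
    by argo+
  then show "(\<And>x. \<chi> (x * r) = 1) \<Longrightarrow> r = 0" "(\<And>x. \<chi> (r * x) = 1) \<Longrightarrow> r = 0"
    by simp_all
qed

text \<open>If the character \<open>\<chi> (a * x)\<close> in \<open>x\<close> differed from every
  \<open>\<chi> (x * s)\<close>, the double sum of \<open>\<chi> (a * x - x * s)\<close> would be 0
  when summed over \<open>x\<close> first. Summed over \<open>s\<close> first, only
  \<open>x = 0\<close> survives and the value is the order of the ring.\<close>

lemma generating_char_nakayama:
  fixes \<chi> :: "'a::{ring_1, finite} \<Rightarrow> complex"
  assumes "generating_char \<chi>"
  shows "\<exists>s. \<forall>x. \<chi> (a * x) = \<chi> (x * s)"
proof (rule ccontr)
  assume "\<not> ?thesis"
  then have ne: "\<exists>x. \<chi> (a * x) \<noteq> \<chi> (x * s)" for s by blast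
  have ac: "additive_char \<chi>"
    using assms unfolding generating_char_def by simp
  then have add: "\<chi> (x + y) = \<chi> x * \<chi> y" and nz: "\<chi> x \<noteq> 0" for x y
    unfolding additive_char_def by auto
  have diff: "\<chi> (x - y) = \<chi> x / \<chi> y" for x y
    using additive_char_uminus[OF ac] add[of x "- y"] by (simp add: divide_inverse)
  have 1: "(\<Sum>x\<in>UNIV. \<chi> (a * x - x * s)) = 0" for s
  proof -
    have "\<not> (\<forall>x. \<chi> (a * x - x * s) = 1)"
      using ne[of s] nz by (simp add: diff)
    then show ?thesis
      using sum_hom_UNIV[of "\<lambda>x. \<chi> (a * x - x * s)"]
      by (simp add: diff distrib_left distrib_right add)
  qed
  have 2: "(\<Sum>s\<in>UNIV. \<chi> (a * x - x * s)) = (if x = 0 then of_nat (card (UNIV :: 'a set)) else 0)" for x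
  proof -
    have "(\<Sum>s\<in>UNIV. \<chi> (a * x - x * s)) = \<chi> (a * x) * (\<Sum>s\<in>UNIV. inverse (\<chi> (x * s)))"
      by (simp add: diff divide_inverse sum_distrib_left)
    also have "(\<Sum>s\<in>UNIV. inverse (\<chi> (x * s))) = (if x = 0 then of_nat (card (UNIV :: 'a set)) else 0)"
    proof -
      have "(\<forall>s. inverse (\<chi> (x * s)) = 1) \<longleftrightarrow> x = 0"
        using generating_char_nondegenerate(2)[OF assms, of x] additive_char_zero[OF ac] by auto
      then show ?thesis
        using sum_hom_UNIV[of "\<lambda>s. inverse (\<chi> (x * s))"] by (simp add: distrib_left add)
    qed
    finally show ?thesis
      using additive_char_zero[OF ac] by simp
  qed
  have "(\<Sum>s\<in>UNIV. \<Sum>x\<in>UNIV. \<chi> (a * x - x * s)) = (\<Sum>x\<in>UNIV. \<Sum>s\<in>UNIV. \<chi> (a * x - x * s))"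
    by (rule sum.swap)
  then show False
    unfolding 1 2 by simp
qed

section \<open>Units and the Nakayama permutation\<close>

lemma one_in_ring_units: "1 \<in> ring_units"
  by (auto simp: ring_units_def)

lemma ring_units_mult: "u \<in> ring_units \<Longrightarrow> v \<in> ring_units \<Longrightarrow> u * v \<in> ring_units"
proof -
  assume "u \<in> ring_units" "v \<in> ring_units"
  then obtain u' v' where "u * u' = 1" "u' * u = 1" "v * v' = 1" "v' * v = 1"
    unfolding ring_units_def by blast
  then have "(u * v) * (v' * u') = 1 \<and> (v' * u') * (u * v) = 1"
    by (metis mult.assoc mult_1_left)
  then show ?thesis unfolding ring_units_def by blast
qed

text \<open>
  The Nakayama map \<open>\<sigma>\<close> with \<open>\<chi> (a x) = \<chi> (x \<sigma>(a))\<close> is multiplicative and injective, hence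
  permutes the units.
\<close>

lemma generating_char_unit_sum_commute:
  fixes \<chi> :: "'a::{ring_1, finite} \<Rightarrow> complex"
  assumes "generating_char \<chi>"
  shows "(\<Sum>u\<in>ring_units. \<chi> (u * x)) = (\<Sum>u\<in>ring_units. \<chi> (x * u))"
proof -
  have ac: "additive_char \<chi>"
    using assms unfolding generating_char_def by simp
  then have add: "\<chi> (x + y) = \<chi> x * \<chi> y" and nz: "\<chi> x \<noteq> 0" for x y
    unfolding additive_char_def by auto
  have diff: "\<chi> (x - y) = \<chi> x / \<chi> y" for x y
    using additive_char_uminus[OF ac] add[of x "- y"] by (simp add: divide_inverse)
  \<comment> \<open>Nondegeneracy allows equations between ring elements to be tested under \<chi>:
    the first form gives multiplicativity of the Nakayama map, the second its injectivity.\<close>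
  have eqI: "a = b" if "\<And>x. \<chi> (x * a) = \<chi> (x * b)" for a b
    using generating_char_nondegenerate(1)[OF assms, of "a - b"] that nz
    by (simp add: right_diff_distrib diff)
  have eqI': "a = b" if "\<And>x. \<chi> (a * x) = \<chi> (b * x)" for a b
    using generating_char_nondegenerate(2)[OF assms, of "a - b"] that nz
    by (simp add: left_diff_distrib diff)
  obtain \<sigma> where \<sigma>: "\<And>a x. \<chi> (a * x) = \<chi> (x * \<sigma> a)"
    using generating_char_nakayama[OF assms] by metis
  have \<sigma>1: "\<sigma> 1 = 1"
    by (rule eqI) (simp add: \<sigma>[symmetric])
  have \<sigma>mult: "\<sigma> (a * b) = \<sigma> a * \<sigma> b" for a b
    by (rule eqI) (metis \<sigma> mult.assoc)
  have inj: "inj_on \<sigma> ring_units"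
    by (rule inj_onI) (metis \<sigma> eqI')
  have "\<sigma> ` ring_units \<subseteq> ring_units"
  proof
    fix y assume "y \<in> \<sigma> ` ring_units"
    then obtain u v where "y = \<sigma> u" "u * v = 1" "v * u = 1"
      unfolding ring_units_def by blast
    then have "y * \<sigma> v = 1 \<and> \<sigma> v * y = 1"
      by (simp add: \<sigma>mult[symmetric] \<sigma>1)
    then show "y \<in> ring_units"
      unfolding ring_units_def by blast
  qed
  then have "bij_betw \<sigma> ring_units ring_units"
    using inj by (simp add: bij_betw_def endo_inj_surj)
  then have "(\<Sum>u\<in>ring_units. \<chi> (x * \<sigma> u)) = (\<Sum>u\<in>ring_units. \<chi> (x * u))"
    by (rule sum.reindex_bij_betw)
  moreover have "(\<Sum>u\<in>ring_units. \<chi> (u * x)) = (\<Sum>u\<in>ring_units. \<chi> (x * \<sigma> u))"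
    by (rule sum.cong[OF refl \<sigma>])
  ultimately show ?thesis by simp
qed

section \<open>Generators of cyclic modules over a finite ring\<close>

text \<open>Moebius inversion on the subset lattice, by induction from large \<open>L\<close>
  downwards: subtracting the fibres over strictly larger sets from the count for
  \<open>L \<subseteq> f x\<close> leaves the fibre over \<open>L\<close>.\<close>

lemma card_fibre_eq:
  fixes f :: "'b \<Rightarrow> 'a::finite set"
  assumes fin: "finite A" "finite B"
    and eq: "\<And>Y. card {x \<in> A. Y \<subseteq> f x} = card {x \<in> B. Y \<subseteq> f x}"
  shows "card {x \<in> A. f x = L} = card {x \<in> B. f x = L}"
proof (induction "card (- L)" arbitrary: L rule: less_induct)
  case less
  have split: "card {x \<in> D. L \<subseteq> f x} = card {x \<in> D. f x = L} + (\<Sum>M | L \<subset> M. card {x \<in> D. f x = M})"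
    if D: "finite D" for D
  proof -
    have "{x \<in> D. L \<subseteq> f x} = {x \<in> D. f x = L} \<union> (\<Union>M\<in>{M. L \<subset> M}. {x \<in> D. f x = M})"
      by auto
    also have "card \<dots> = card {x \<in> D. f x = L} + card (\<Union>M\<in>{M. L \<subset> M}. {x \<in> D. f x = M})"
      by (rule card_Un_disjoint) (use D in auto)
    also have "card (\<Union>M\<in>{M. L \<subset> M}. {x \<in> D. f x = M}) = (\<Sum>M | L \<subset> M. card {x \<in> D. f x = M})"
      by (rule card_UN_disjoint) (use D in auto)
    finally show ?thesis .
  qed
  have "card {x \<in> A. f x = M} = card {x \<in> B. f x = M}" if "L \<subset> M" for M
    by (rule less) (use that in \<open>auto intro!: psubset_card_mono\<close>)
  then have "(\<Sum>M | L \<subset> M. card {x \<in> A. f x = M}) = (\<Sum>M | L \<subset> M. card {x \<in> B. f x = M})"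
    by (intro sum.cong) auto
  then show ?case
    using split[OF fin(1)] split[OF fin(2)] eq[of L] by simp
qed

text \<open>Right multiplication by \<open>x\<close> is injective, hence surjective by finiteness,
  which yields a left inverse \<open>y\<close>. Cancelling \<open>x\<close> in
  \<open>(x * y - 1) * x = 0\<close> makes it two-sided.\<close>

lemma left_regular_imp_unit:
  fixes x :: "'a::{ring_1, finite}"
  assumes "\<And>y. y * x = 0 \<Longrightarrow> y = 0"
  shows "x \<in> ring_units"
proof -
  have "inj (\<lambda>y. y * x)"
    by (rule injI) (metis assms eq_iff_diff_eq_0 left_diff_distrib)
  then have "surj (\<lambda>y. y * x)"
    by (simp add: finite_UNIV_inj_surj)
  then obtain y where y: "y * x = 1"
    by (metis surjD)
  have "(x * y - 1) * x = 0"
    by (simp add: left_diff_distrib mult.assoc y)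
  then have "x * y = 1"
    using assms by (metis eq_iff_diff_eq_0)
  then show ?thesis
    using y by (auto simp: ring_units_def)
qed

text \<open>
  Finite rings have stable range 1. For every set \<open>Y\<close>, the cosets \<open>1 + I\<close> and \<open>b + I\<close> contain
  equally many elements annihilated by \<open>Y\<close> from the left: right multiplication by \<open>b\<close> and \<open>a\<close>
  maps each coset into the other, so both sets are empty or cosets of the same group. By Moebius inversion they contain equally many elements with
  zero left annihilator, and \<open>1\<close> is such an element.
\<close>

lemma unit_in_coset_right_ideal:
  fixes I :: "'a::{ring_1, finite} set"
  assumes I: "right_ideal I" and ba: "b * a - 1 \<in> I"
  shows "\<exists>u \<in> ring_units. u - b \<in> I"
proof -
  have I0: "0 \<in> I" and Iadd: "x \<in> I \<Longrightarrow> y \<in> I \<Longrightarrow> x + y \<in> I" and Imul: "x \<in> I \<Longrightarrow> x * r \<in> I" for x y r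
    using I unfolding right_ideal_def by auto
  have Idiff: "x - y \<in> I" if "x \<in> I" "y \<in> I" for x y
    using Iadd[OF that(1) Imul[OF that(2), of "- 1"]] by simp
  define A where "A = {x. x - 1 \<in> I}"
  define B where "B = {x. x - b \<in> I}"
  define ann where "ann x = {y. y * x = 0}" for x :: 'a
  have AB: "x * b \<in> B" if "x \<in> A" for x
    using Imul[of "x - 1" b] that by (simp add: A_def B_def left_diff_distrib)
  \<comment> \<open>Here \<open>x * a - 1 = (x - b) * a + (b * a - 1)\<close>, and both summands lie
    in \<open>I\<close>.\<close>
  have BA: "x * a \<in> A" if "x \<in> B" for x
    using Iadd[OF Imul[of "x - b" a] ba] that by (simp add: A_def B_def left_diff_distrib)
  have "card {x \<in> A. Y \<subseteq> ann x} = card {x \<in> B. Y \<subseteq> ann x}" for Y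
  proof (cases "{x \<in> A. Y \<subseteq> ann x} = {}")
    case True
    have empty: "{x \<in> B. Y \<subseteq> ann x} = {}"
    proof (rule ccontr)
      assume "{x \<in> B. Y \<subseteq> ann x} \<noteq> {}"
      then obtain x where "x \<in> B" "Y \<subseteq> ann x" by blast
      then have "x * a \<in> A" "Y \<subseteq> ann (x * a)"
        using BA by (auto simp: ann_def mult.assoc[symmetric])
      then show False using True by blast
    qed
    show ?thesis unfolding True empty ..
  next
    case False
    then obtain x0 where x0: "x0 \<in> A" "Y \<subseteq> ann x0" by blast
    \<comment> \<open>Mutually inverse translations; \<open>?f\<close> sends \<open>x0\<close> to
      \<open>x0 * b\<close>, which lies in \<open>B\<close> and is still annihilated by
      \<open>Y\<close>.\<close>
    let ?f = "\<lambda>x. x - x0 + x0 * b" and ?g = "\<lambda>x. x - x0 * b + x0"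
    have x0b: "x0 * b \<in> B" "Y \<subseteq> ann (x0 * b)"
      using AB x0 by (auto simp: ann_def mult.assoc[symmetric])
    have "?f x \<in> B \<and> Y \<subseteq> ann (?f x)" if "x \<in> A" "Y \<subseteq> ann x" for x
    proof -
      have "(x - 1) - (x0 - 1) + (x0 * b - b) \<in> I"
        by (rule Iadd[OF Idiff]) (use that x0 x0b in \<open>auto simp: A_def B_def\<close>)
      then have "?f x \<in> B" by (simp add: B_def algebra_simps)
      moreover have "y * ?f x = 0" if "y \<in> Y" for y
      proof -
        have "y * x = 0" "y * x0 = 0" "y * (x0 * b) = 0"
          using that \<open>Y \<subseteq> ann x\<close> x0 x0b unfolding ann_def by blast+
        then show ?thesis by (simp add: distrib_left right_diff_distrib)
      qed
      ultimately show ?thesis by (auto simp: ann_def)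
    qed
    moreover have "?g x \<in> A \<and> Y \<subseteq> ann (?g x)" if "x \<in> B" "Y \<subseteq> ann x" for x
    proof -
      have "(x - b) - (x0 * b - b) + (x0 - 1) \<in> I"
        by (rule Iadd[OF Idiff]) (use that x0 x0b in \<open>auto simp: A_def B_def\<close>)
      then have "?g x \<in> A" by (simp add: A_def algebra_simps)
      moreover have "y * ?g x = 0" if "y \<in> Y" for y
      proof -
        have "y * x = 0" "y * x0 = 0" "y * (x0 * b) = 0"
          using that \<open>Y \<subseteq> ann x\<close> x0 x0b unfolding ann_def by blast+
        then show ?thesis by (simp add: distrib_left right_diff_distrib)
      qed
      ultimately show ?thesis by (auto simp: ann_def)
    qed
    ultimately have "bij_betw ?f {x \<in> A. Y \<subseteq> ann x} {x \<in> B. Y \<subseteq> ann x}"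
      by (intro bij_betwI[where g = ?g]) auto
    then show ?thesis by (rule bij_betw_same_card)
  qed
  then have "card {x \<in> A. ann x = {0}} = card {x \<in> B. ann x = {0}}"
    by (intro card_fibre_eq) auto
  moreover have "1 \<in> {x \<in> A. ann x = {0}}"
    by (auto simp: A_def ann_def I0)
  ultimately have "{x \<in> B. ann x = {0}} \<noteq> {}"
    by (metis (no_types, lifting) card.empty card_0_eq empty_iff finite)
  then obtain u where "u \<in> B" "ann u = {0}" by blast
  then have "u \<in> ring_units"
    by (intro left_regular_imp_unit) (auto simp: ann_def)
  with \<open>u \<in> B\<close> show ?thesis by (auto simp: B_def)
qed

section \<open>Right multiples of vectors and unit orbits\<close>

lemma right_smult_vec_index [simp]:
  "i < dim_vec g \<Longrightarrow> right_smult_vec g r $ i = g $ i * r"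
  "dim_vec (right_smult_vec g r) = dim_vec g"
  by (auto simp: right_smult_vec_def)

lemma right_smult_vec_assoc: "right_smult_vec (right_smult_vec g r) s = right_smult_vec g (r * s)"
  by (rule eq_vecI) (auto simp: mult.assoc)

lemma right_smult_vec_one [simp]: "right_smult_vec g 1 = g"
  by (rule eq_vecI) auto

text \<open>With \<open>h = g b\<close> and \<open>g = h a\<close>, the element
  \<open>b * a - 1\<close> lies in the right annihilator of \<open>g\<close>, a right ideal. A unit
  congruent to \<open>b\<close> modulo this ideal maps \<open>g\<close> to the same vector as
  \<open>b\<close> does.\<close>

lemma cyclic_submodule_eq_imp_unit:
  fixes g h :: "'a::{ring_1, finite} vec"
  assumes "cyclic_submodule g = cyclic_submodule h"
  shows "\<exists>u\<in>ring_units. h = right_smult_vec g u"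
proof -
  have mem: "x \<in> cyclic_submodule x" for x :: "'a vec"
    unfolding cyclic_submodule_def by (rule CollectI, rule exI[of _ 1]) simp
  obtain b where b: "h = right_smult_vec g b"
    using mem[of h] assms unfolding cyclic_submodule_def by auto
  obtain a where a: "g = right_smult_vec h a"
    using mem[of g] assms unfolding cyclic_submodule_def by auto
  let ?I = "{t. \<forall>i<dim_vec g. g $ i * t = 0}"
  have "right_ideal ?I"
    by (auto simp: right_ideal_def distrib_left mult.assoc[symmetric])
  moreover have "b * a - 1 \<in> ?I"
  proof clarsimp
    fix i assume i: "i < dim_vec g"
    have "g = right_smult_vec g (b * a)"
      using a b right_smult_vec_assoc by metis
    then have "g $ i = g $ i * (b * a)"
      using i right_smult_vec_index(1) by metis
    then show "g $ i * (b * a - 1) = 0"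
      by (simp add: right_diff_distrib)
  qed
  ultimately obtain u where u: "u \<in> ring_units" "u - b \<in> ?I"
    using unit_in_coset_right_ideal by blast
  then have "h = right_smult_vec g u"
    by (intro eq_vecI) (auto simp: b right_diff_distrib)
  with u show ?thesis by blast
qed

lemma cyclic_submodule_unit:
  assumes "u \<in> ring_units"
  shows "cyclic_submodule (right_smult_vec g u) = cyclic_submodule g"
proof -
  obtain v where "u * v = 1"
    using assms unfolding ring_units_def by blast
  then have "right_smult_vec g r = right_smult_vec (right_smult_vec g u) (v * r)" for r
    by (simp add: right_smult_vec_assoc mult.assoc[symmetric])
  then show ?thesis
    unfolding cyclic_submodule_def using right_smult_vec_assoc by blast
qed

text \<open>Orbit-stabilizer count for the units acting on \<open>g\<close> from the right. Right
  multiplication by the inverse of \<open>w\<close> maps the fibre over \<open>g w\<close> onto the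
  stabilizer, so all fibres have the same size.\<close>

lemma card_unit_stabilizer:
  fixes g :: "'a::{ring_1, finite} vec"
  shows "card (ring_units :: 'a set) = card (unit_orbit g) * card {v \<in> ring_units. right_smult_vec g v = g}"
    and "w \<in> ring_units \<Longrightarrow>
      card {v \<in> ring_units. right_smult_vec g v = right_smult_vec g w} = card {v \<in> ring_units. right_smult_vec g v = g}"
proof -
  show fibre: "card {v \<in> ring_units. right_smult_vec g v = right_smult_vec g w} = card {v \<in> ring_units. right_smult_vec g v = g}"
    if w: "w \<in> ring_units" for w
  proof -
    obtain w' where w': "w * w' = 1" "w' * w = 1"
      using w unfolding ring_units_def by blast
    then have w'u: "w' \<in> ring_units" unfolding ring_units_def by blast
    have "right_smult_vec g (v * w') = g" if "right_smult_vec g v = right_smult_vec g w" for v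
      using that w' by (metis right_smult_vec_assoc right_smult_vec_one)
    moreover have "right_smult_vec g (v * w) = right_smult_vec g w" if "right_smult_vec g v = g" for v
      using that by (metis right_smult_vec_assoc)
    ultimately have "bij_betw (\<lambda>v. v * w') {v \<in> ring_units. right_smult_vec g v = right_smult_vec g w}
       {v \<in> ring_units. right_smult_vec g v = g}"
      by (intro bij_betwI[where g = "\<lambda>v. v * w"]) (auto simp: w w' w'u ring_units_mult mult.assoc)
    then show ?thesis by (rule bij_betw_same_card)
  qed
  have "card (ring_units :: 'a set) = (\<Sum>h\<in>unit_orbit g. card {v \<in> ring_units. right_smult_vec g v = h})"
  proof -
    have orb: "unit_orbit g = right_smult_vec g ` ring_units"
      unfolding unit_orbit_def by blast
    have "(\<Sum>h\<in>right_smult_vec g ` ring_units. card {v \<in> ring_units. right_smult_vec g v = h})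
      = card (\<Union>h\<in>right_smult_vec g ` ring_units. {v \<in> ring_units. right_smult_vec g v = h})"
      by (rule card_UN_disjoint[symmetric]) auto
    also have "(\<Union>h\<in>right_smult_vec g ` ring_units. {v \<in> ring_units. right_smult_vec g v = h}) = ring_units"
      by auto
    finally show ?thesis by (simp add: orb)
  qed
  also have "\<dots> = (\<Sum>h\<in>unit_orbit g. card {v \<in> ring_units. right_smult_vec g v = g})"
    by (rule sum.cong) (auto simp: unit_orbit_def fibre)
  finally show "card (ring_units :: 'a set) = card (unit_orbit g) * card {v \<in> ring_units. right_smult_vec g v = g}"
    by simp
qed

section \<open>Trivial strongly regular graphs\<close>

text \<open>The nonadjacent pair ties \<open>m\<close> to the graph; in a complete graph any
  \<open>m\<close> would do. As \<open>m\<close> is nonzero, the pair has a common neighbour, which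
  rules out a union of cliques. For the complement, triviality means that nonadjacent vertices have
  the same neighbours, that is \<open>m = K\<close>.\<close>

lemma strongly_regular_trivial_iff:
  assumes srg: "strongly_regular G N K l m"
    and nonadj: "u \<in> pverts G" "v \<in> pverts G" "u \<noteq> v" "(u, v) \<notin> parcs G"
    and m: "m \<noteq> 0"
  shows "trivial_srg G \<longleftrightarrow> m = K"
proof
  have pg: "pair_graph G" and K: "\<And>v. v \<in> pverts G \<Longrightarrow> card (neighbours G v) = K"
    and mu: "\<And>u v. u \<in> pverts G \<Longrightarrow> v \<in> pverts G \<Longrightarrow> u \<noteq> v \<Longrightarrow> (u, v) \<notin> parcs G \<Longrightarrow>
        card (neighbours G u \<inter> neighbours G v) = m"
    and N: "card (pverts G) = N"
    using srg unfolding strongly_regular_def by auto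
  interpret pair_graph G by (rule pg)
  have sym: "(y, x) \<in> parcs G" if "(x, y) \<in> parcs G" for x y
    using pair_sym_arcs that by (auto simp: symmetric_def sym_def)
  have irr: "(x, x) \<notin> parcs G" for x
    using pair_no_loops[of "(x, x)"] by auto
  have fin: "finite (neighbours G x)" for x
    using pair_finite_verts by (simp add: neighbours_def)
  show "m = K" if "trivial_srg G"
    using that unfolding trivial_srg_def
  proof
    assume "disjoint_union_of_equal_cliques G"
    then obtain P where P: "partition_on (pverts G) P"
      "parcs G = {(u, v). u \<noteq> v \<and> (\<exists>X\<in>P. u \<in> X \<and> v \<in> X)}"
      unfolding disjoint_union_of_equal_cliques_def by blast
    have "neighbours G u \<inter> neighbours G v \<noteq> {}"
      using mu[OF nonadj] m by (metis card.empty)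
    then obtain z where "(u, z) \<in> parcs G" "(v, z) \<in> parcs G"
      by (auto simp: neighbours_def)
    then obtain X Y where XY: "X \<in> P" "u \<in> X" "z \<in> X" "Y \<in> P" "v \<in> Y" "z \<in> Y"
      unfolding P(2) by auto
    then have "X = Y"
      using partition_onD2[OF P(1)] by (auto simp: disjoint_def)
    then have "(u, v) \<in> parcs G"
      unfolding P(2) using nonadj XY by auto
    then show ?thesis using nonadj by simp
  next
    assume "disjoint_union_of_equal_cliques (graph_complement G)"
    then obtain P where P: "partition_on (pverts G) P"
      "parcs (graph_complement G) = {(u, v). u \<noteq> v \<and> (\<exists>X\<in>P. u \<in> X \<and> v \<in> X)}"
      unfolding disjoint_union_of_equal_cliques_def graph_complement_def by auto
    have "(u, v) \<in> parcs (graph_complement G)"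
      using nonadj by (simp add: graph_complement_def)
    then obtain X where X: "X \<in> P" "u \<in> X" "v \<in> X"
      unfolding P(2) by auto
    \<comment> \<open>The clique of the complement through \<open>x\<close> consists of
      \<open>x\<close> and its non-neighbours in \<open>G\<close>.\<close>
    have "neighbours G x = pverts G - X" if x: "x \<in> X" for x
    proof -
      have xV: "x \<in> pverts G"
        using partition_onD1[OF P(1)] X x by blast
      have "(x, z) \<in> parcs G \<longleftrightarrow> z \<notin> X" if z: "z \<in> pverts G" for z
      proof -
        have "(x, z) \<in> parcs (graph_complement G) \<longleftrightarrow> x \<noteq> z \<and> z \<in> X"
          unfolding P(2) using X(1) x partition_onD2[OF P(1)] by (auto simp: disjoint_def)
        then show ?thesis
          using xV z x irr by (auto simp: graph_complement_def)
      qed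
      then show ?thesis by (auto simp: neighbours_def)
    qed
    then have "neighbours G u = neighbours G v"
      using X by simp
    then show ?thesis
      using mu[OF nonadj] K[OF nonadj(1)] by simp
  qed
  show "trivial_srg G" if "m = K"
  proof -
    have nb: "neighbours G x = neighbours G y"
      if "x \<in> pverts G" "y \<in> pverts G" "(x, y) \<notin> parcs G" for x y
    proof (cases "x = y")
      case False
      \<comment> \<open>The intersection has \<open>m = K\<close> elements, as many as either
        neighbourhood.\<close>
      have "neighbours G x \<inter> neighbours G y = neighbours G x"
        by (rule card_subset_eq) (use fin K mu that False \<open>m = K\<close> in auto)
      moreover have "neighbours G x \<inter> neighbours G y = neighbours G y"
        by (rule card_subset_eq) (use fin K mu that False \<open>m = K\<close> in auto)
      ultimately show ?thesis by simp
    qed simp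
    \<comment> \<open>Absence of loops puts \<open>x\<close> into \<open>B x\<close>; these sets
      turn out to be the classes of the nonadjacency relation, each of size
      \<open>N - K\<close>.\<close>
    define B where "B x = pverts G - neighbours G x" for x
    have self: "x \<in> B x" if "x \<in> pverts G" for x
      using that irr by (simp add: B_def neighbours_def)
    have Beq: "B x = B y" if "x \<in> pverts G" "y \<in> B x" for x y
    proof -
      have "y \<in> pverts G" "(x, y) \<notin> parcs G"
        using that by (auto simp: B_def neighbours_def)
      then show ?thesis using nb[of x y] that by (simp add: B_def)
    qed
    have part: "partition_on (pverts G) (B ` pverts G)"
    proof (rule partition_onI)
      show "\<Union> (B ` pverts G) = pverts G"
        using self by (auto simp: B_def)
      show "{} \<notin> B ` pverts G"
        using self by blast
      show "disjnt p q" if "p \<in> B ` pverts G" "q \<in> B ` pverts G" "p \<noteq> q" for p q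
        using that Beq unfolding disjnt_def by blast
    qed
    have "card X = N - K" if "X \<in> B ` pverts G" for X
      using that K N fin by (auto simp: B_def neighbours_def card_Diff_subset)
    moreover have "parcs (graph_complement G) = {(u, v). u \<noteq> v \<and> (\<exists>X\<in>B ` pverts G. u \<in> X \<and> v \<in> X)}"
    proof (intro equalityI subsetI; clarify)
      fix x y assume "(x, y) \<in> parcs (graph_complement G)"
      then have xy: "x \<in> pverts G" "y \<in> pverts G" "x \<noteq> y" "(x, y) \<notin> parcs G"
        by (auto simp: graph_complement_def)
      then have "x \<in> B x" "y \<in> B x"
        using self by (auto simp: B_def neighbours_def)
      then show "x \<noteq> y \<and> (\<exists>X\<in>B ` pverts G. x \<in> X \<and> y \<in> X)"
        using xy by blast
    next
      fix x y z assume *: "x \<noteq> y" "z \<in> pverts G" "x \<in> B z" "y \<in> B z"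
      then have "y \<in> B x" using Beq by blast
      then show "(x, y) \<in> parcs (graph_complement G)"
        using * by (auto simp: graph_complement_def B_def neighbours_def)
    qed
    ultimately have "disjoint_union_of_equal_cliques (graph_complement G)"
      unfolding disjoint_union_of_equal_cliques_def using part
      by (intro exI[of _ "B ` pverts G"] exI[of _ "N - K"]) (simp add: graph_complement_def)
    then show ?thesis by (simp add: trivial_srg_def)
  qed
qed

section \<open>The character form of the weight of a code\<close>

lemma finite_carrier_vec: "finite (carrier_vec n :: 'a::finite vec set)"
proof -
  have "carrier_vec n \<subseteq> vec_of_list ` {xs :: 'a list. set xs \<subseteq> UNIV \<and> length xs = n}"
  proof
    fix v :: "'a vec" assume "v \<in> carrier_vec n"
    then have "v = vec_of_list (list_of_vec v)" "length (list_of_vec v) = n"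
      by (auto simp: vec_list)
    then show "v \<in> vec_of_list ` {xs. set xs \<subseteq> UNIV \<and> length xs = n}"
      by blast
  qed
  then show ?thesis
    by (rule finite_subset) (rule finite_imageI[OF finite_lists_length_eq[OF finite_UNIV]])
qed

locale frobenius_code =
  fixes \<chi> :: "'a::{ring_1, finite} \<Rightarrow> complex" and n :: nat and C :: "'a vec set"
  assumes generating: "generating_char \<chi>" and linear: "left_linear_code n C"
begin

abbreviation U :: "'a set" where "U \<equiv> ring_units"
abbreviation w :: "'a vec \<Rightarrow> real" where "w \<equiv> hom_weight_vec \<chi>"
abbreviation C0 :: "'a vec set" where "C0 \<equiv> weight_zero_subcode \<chi> C"

definition F :: "'a vec \<Rightarrow> real" where "F x = real n - w x"
text \<open>A pair \<open>(j, u)\<close> labels the functional sending a codeword \<open>c\<close>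
  to \<open>c $ j * u\<close>. Different pairs may give the same functional on \<open>C\<close>;
  modularity controls how often.\<close>

definition index :: "(nat \<times> 'a) set" where "index = {..<n} \<times> U"
text \<open>The unit stands on the right, which makes \<open>ev p\<close> a homomorphism of left
  modules on \<open>C\<close>; in the weight itself the units stand on the left.\<close>

definition ev :: "nat \<times> 'a \<Rightarrow> 'a vec \<Rightarrow> 'a" where "ev p x = x $ fst p * snd p"

lemma additive: "additive_char \<chi>"
  using generating unfolding generating_char_def by simp

lemma char_add: "\<chi> (x + y) = \<chi> x * \<chi> y"
  using additive unfolding additive_char_def by auto

lemma char_minus: "\<chi> (- x) = cnj (\<chi> x)"
  using additive_char_norm[OF additive, of x] additive_char_uminus[OF additive, of x]
  by (simp add: divide_conv_cnj inverse_eq_divide)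

lemma char_zero: "\<chi> 0 = 1"
  by (rule additive_char_zero[OF additive])

lemma units_nonempty: "U \<noteq> {}"
  using one_in_ring_units by blast

lemma card_units_pos: "card U > 0"
  using units_nonempty by (simp add: card_gt_0_iff)

lemma finite_index: "finite index"
  by (simp add: index_def)

lemma code_carrier: "C \<subseteq> carrier_vec n"
  and code_zero: "0\<^sub>v n \<in> C"
  and code_add: "x \<in> C \<Longrightarrow> y \<in> C \<Longrightarrow> x + y \<in> C"
  and code_smult: "x \<in> C \<Longrightarrow> r \<cdot>\<^sub>v x \<in> C"
  using linear unfolding left_linear_code_def by simp_all

lemma code_dim: "x \<in> C \<Longrightarrow> dim_vec x = n"
  using code_carrier by auto

lemma code_diff: "x - y \<in> C" if "x \<in> C" "y \<in> C"
proof -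
  have "x - y = x + (- 1) \<cdot>\<^sub>v y"
    by (rule eq_vecI) (simp_all add: code_dim that)
  then show ?thesis using that by (simp only: code_add code_smult)
qed

lemma finite_code: "finite C"
  by (rule finite_subset[OF code_carrier finite_carrier_vec])

text \<open>Orthogonality for left linear functionals. If \<open>L d\<close> is nonzero,
  nondegeneracy gives a ring element \<open>x\<close> with
  \<open>\<chi> (x * L d) \<noteq> 1\<close>, and translation by the codeword \<open>x d\<close>
  multiplies the sum by this value. Thus \<open>L\<close> itself has to vanish for a nonzero
  sum.\<close>

lemma sum_char_functional:
  assumes add: "\<And>x y. x \<in> C \<Longrightarrow> y \<in> C \<Longrightarrow> L (x + y) = L x + L y"
    and smult: "\<And>r x. x \<in> C \<Longrightarrow> L (r \<cdot>\<^sub>v x) = r * L x"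
  shows "(\<Sum>d\<in>C. \<chi> (L d)) = (if \<forall>d\<in>C. L d = 0 then of_nat (card C) else 0)"
proof (cases "\<forall>d\<in>C. L d = 0")
  case True
  then show ?thesis by (simp add: char_zero)
next
  case False
  then obtain d where d: "d \<in> C" "L d \<noteq> 0" by blast
  then obtain x where x: "\<chi> (x * L d) \<noteq> 1"
    using generating_char_nondegenerate(1)[OF generating] by blast
  let ?a = "x \<cdot>\<^sub>v d"
  have a: "?a \<in> C" using d by (simp add: code_smult)
  have "bij_betw (\<lambda>y. ?a + y) C C"
  proof (rule bij_betwI[where g = "\<lambda>y. y - ?a"])
    show "?a + y - ?a = y" "?a + (y - ?a) = y" if "y \<in> C" for y
      by (rule eq_vecI; simp add: code_dim that d)+
  qed (use a in \<open>auto intro: code_add code_diff\<close>)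
  moreover have "\<chi> (L (?a + y)) = \<chi> (x * L d) * \<chi> (L y)" if "y \<in> C" for y
    using that a d by (simp add: add smult char_add)
  ultimately have "(\<Sum>d\<in>C. \<chi> (L d)) = 0"
    using x by (rule sum_eq_zero_by_translation)
  then show ?thesis using False by auto
qed

lemma ev_add: "x \<in> C \<Longrightarrow> y \<in> C \<Longrightarrow> p \<in> index \<Longrightarrow> ev p (x + y) = ev p x + ev p y"
  and ev_diff: "x \<in> C \<Longrightarrow> y \<in> C \<Longrightarrow> p \<in> index \<Longrightarrow> ev p (x - y) = ev p x - ev p y"
  and ev_smult: "x \<in> C \<Longrightarrow> p \<in> index \<Longrightarrow> ev p (r \<cdot>\<^sub>v x) = r * ev p x"
  by (auto simp: ev_def index_def code_dim distrib_right left_diff_distrib mult.assoc)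

text \<open>The unit sum can be moved to the right by
  \<open>generating_char_unit_sum_commute\<close>; the \<open>n\<close> constants 1 in the weight
  cancel against \<open>n\<close> in \<open>F\<close>.\<close>

lemma F_expand:
  assumes x: "x \<in> C"
  shows "complex_of_real (F x) = (\<Sum>p\<in>index. \<chi> (ev p x)) / of_nat (card U)"
proof -
  have "complex_of_real (w x) = (\<Sum>j<n. 1 - (\<Sum>u\<in>U. \<chi> (x $ j * u)) / of_nat (card U))"
    using x by (simp add: hom_weight_vec_def code_dim hom_weight_eq[OF additive]
        generating_char_unit_sum_commute[OF generating])
  also have "\<dots> = of_nat n - (\<Sum>p\<in>index. \<chi> (ev p x)) / of_nat (card U)"
    by (simp add: sum_subtractf sum_divide_distrib index_def ev_def sum.cartesian_product split_def)
  finally show ?thesis by (simp add: F_def)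
qed

text \<open>\<open>F\<close> is real and conjugation negates the argument of \<chi>. In a product of
  two values of \<open>F\<close>, this form supplies the conjugate characters needed for
  orthogonality.\<close>

lemma F_expand_minus:
  assumes x: "x \<in> C"
  shows "complex_of_real (F x) = (\<Sum>p\<in>index. \<chi> (- ev p x)) / of_nat (card U)"
proof -
  have "complex_of_real (F x) = cnj (complex_of_real (F x))" by simp
  also have "\<dots> = (\<Sum>p\<in>index. \<chi> (- ev p x)) / of_nat (card U)"
    by (subst F_expand[OF x]) (simp add: char_minus)
  finally show ?thesis .
qed

lemma F_diff_commute:
  assumes "x \<in> C" "y \<in> C"
  shows "F (x - y) = F (y - x)"
proof -
  have "complex_of_real (F (x - y)) = (\<Sum>p\<in>index. \<chi> (- ev p (x - y))) / of_nat (card U)"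
    by (rule F_expand_minus[OF code_diff[OF assms]])
  also have "(\<Sum>p\<in>index. \<chi> (- ev p (x - y))) = (\<Sum>p\<in>index. \<chi> (ev p (y - x)))"
    by (rule sum.cong) (use assms in \<open>auto simp: ev_diff\<close>)
  also have "\<dots> / of_nat (card U) = complex_of_real (F (y - x))"
    by (rule F_expand[OF code_diff[OF assms(2,1)], symmetric])
  finally show ?thesis by (simp only: of_real_eq_iff)
qed

lemma weight_diff_commute: "x \<in> C \<Longrightarrow> y \<in> C \<Longrightarrow> w (x - y) = w (y - x)"
  using F_diff_commute[of x y] by (simp add: F_def)

text \<open>The substitution of \<open>c - d\<close> for \<open>d\<close> removes \<open>c\<close>.
  Each \<open>ev p\<close> is a nonzero functional, because no coordinate vanishes on all of
  \<open>C\<close> and a unit factor can be cancelled, so each character in the expansion sums to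
  0.\<close>

lemma sum_F_translate:
  assumes c: "c \<in> C" and nz: "no_zero_coordinate n C"
  shows "(\<Sum>d\<in>C. F (c - d)) = 0"
proof -
  have zero: "(\<Sum>d\<in>C. \<chi> (ev p d)) = 0" if p: "p \<in> index" for p
  proof -
    obtain j u where ju: "p = (j, u)" "j < n" "u \<in> U"
      using p by (auto simp: index_def)
    obtain d where d: "d \<in> C" "d $ j \<noteq> 0"
      using nz ju unfolding no_zero_coordinate_def by blast
    obtain v where "u * v = 1"
      using ju unfolding ring_units_def by blast
    then have "ev p d \<noteq> 0"
      using d ju by (metis ev_def fst_conv snd_conv mult.assoc mult_1_right mult_zero_left)
    then show ?thesis
      using sum_char_functional[of "ev p"] d p by (auto simp: ev_add ev_smult)
  qed
  have "c - (c - d) = d" if "d \<in> C" for d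
    by (rule eq_vecI) (simp_all add: code_dim that c)
  then have "bij_betw (\<lambda>d. c - d) C C"
    by (intro bij_betwI[where g = "\<lambda>d. c - d"]) (auto intro: code_diff c)
  then have translate: "(\<Sum>d\<in>C. F (c - d)) = (\<Sum>d\<in>C. F d)"
    by (rule sum.reindex_bij_betw)
  have "complex_of_real (\<Sum>d\<in>C. F d) = (\<Sum>d\<in>C. (\<Sum>p\<in>index. \<chi> (ev p d)) / of_nat (card U))"
    by (simp add: F_expand)
  also have "\<dots> = (\<Sum>p\<in>index. \<Sum>d\<in>C. \<chi> (ev p d)) / of_nat (card U)"
    by (simp add: sum_divide_distrib[symmetric] sum.swap[of _ C])
  also have "\<dots> = complex_of_real 0"
    by (simp add: zero)
  finally show ?thesis
    unfolding translate of_real_eq_iff .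
qed

text \<open>Expanding both factors, orthogonality keeps exactly the pairs \<open>(p, q)\<close>
  whose functionals agree on \<open>C\<close>. Since every \<open>p\<close> has \<open>m\<close>
  partners, the surviving terms reassemble to a multiple of \<open>F\<close>.\<close>

lemma F_convolution:
  assumes c: "c \<in> C" "c' \<in> C"
    and m: "\<And>p. p \<in> index \<Longrightarrow> card {q \<in> index. \<forall>d\<in>C. ev q d = ev p d} = m"
  shows "(\<Sum>d\<in>C. F (c - d) * F (c' - d)) = real m * real (card C) / real (card U) * F (c - c')"
proof -
  let ?u = "of_nat (card U) :: complex"
  have orth: "(\<Sum>d\<in>C. \<chi> (ev q d - ev p d)) = (if \<forall>d\<in>C. ev q d = ev p d then of_nat (card C) else 0)"
    if "p \<in> index" "q \<in> index" for p q
    using sum_char_functional[of "\<lambda>d. ev q d - ev p d"] that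
    by (simp add: ev_add ev_smult right_diff_distrib)
  \<comment> \<open>Separates the part depending on \<open>d\<close> from a constant, which becomes
    \<open>\<chi> (ev p (c - c'))\<close> when \<open>ev p\<close> and \<open>ev q\<close> agree on
    \<open>C\<close>.\<close>
  have factor: "\<chi> (ev p (c - d)) * \<chi> (- ev q (c' - d)) = \<chi> (ev p c - ev q c') * \<chi> (ev q d - ev p d)"
    if "p \<in> index" "q \<in> index" "d \<in> C" for p q d
    using that c by (simp add: ev_diff char_add[symmetric] algebra_simps)
  have inner: "(\<Sum>q\<in>index. \<Sum>d\<in>C. \<chi> (ev p (c - d)) * \<chi> (- ev q (c' - d)))
      = of_nat m * of_nat (card C) * \<chi> (ev p (c - c'))" if p: "p \<in> index" for p
  proof -
    have "(\<Sum>q\<in>index. \<Sum>d\<in>C. \<chi> (ev p (c - d)) * \<chi> (- ev q (c' - d)))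
      = (\<Sum>q\<in>index. if \<forall>d\<in>C. ev q d = ev p d then \<chi> (ev p (c - c')) * of_nat (card C) else 0)"
    proof (rule sum.cong[OF refl])
      fix q assume q: "q \<in> index"
      have "(\<Sum>d\<in>C. \<chi> (ev p (c - d)) * \<chi> (- ev q (c' - d)))
          = (\<Sum>d\<in>C. \<chi> (ev p c - ev q c') * \<chi> (ev q d - ev p d))"
        by (rule sum.cong[OF refl]) (rule factor[OF p q])
      also have "\<dots> = \<chi> (ev p c - ev q c') * (\<Sum>d\<in>C. \<chi> (ev q d - ev p d))"
        by (rule sum_distrib_left[symmetric])
      also have "\<dots> = (if \<forall>d\<in>C. ev q d = ev p d then \<chi> (ev p (c - c')) * of_nat (card C) else 0)"
        using c p by (auto simp: orth[OF p q] ev_diff)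
      finally show "(\<Sum>d\<in>C. \<chi> (ev p (c - d)) * \<chi> (- ev q (c' - d)))
        = (if \<forall>d\<in>C. ev q d = ev p d then \<chi> (ev p (c - c')) * of_nat (card C) else 0)" .
    qed
    also have "\<dots> = (\<Sum>q\<in>{q \<in> index. \<forall>d\<in>C. ev q d = ev p d}. \<chi> (ev p (c - c')) * of_nat (card C))"
      by (rule sum.inter_filter[OF finite_index, symmetric])
    also have "\<dots> = of_nat m * of_nat (card C) * \<chi> (ev p (c - c'))"
      using m[OF p] by simp
    finally show ?thesis .
  qed
  have "complex_of_real (\<Sum>d\<in>C. F (c - d) * F (c' - d))
    = (\<Sum>d\<in>C. ((\<Sum>p\<in>index. \<chi> (ev p (c - d))) / ?u) * ((\<Sum>q\<in>index. \<chi> (- ev q (c' - d))) / ?u))"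
    unfolding of_real_sum of_real_mult
    by (rule sum.cong[OF refl])
      (simp only: F_expand[OF code_diff[OF c(1)]] F_expand_minus[OF code_diff[OF c(2)]])
  also have "\<dots> = (\<Sum>d\<in>C. (\<Sum>p\<in>index. \<Sum>q\<in>index. \<chi> (ev p (c - d)) * \<chi> (- ev q (c' - d))) / (?u * ?u))"
    by (simp add: sum_product)
  also have "\<dots> = (\<Sum>d\<in>C. \<Sum>p\<in>index. \<Sum>q\<in>index. \<chi> (ev p (c - d)) * \<chi> (- ev q (c' - d))) / (?u * ?u)"
    by (rule sum_divide_distrib[symmetric])
  also have "(\<Sum>d\<in>C. \<Sum>p\<in>index. \<Sum>q\<in>index. \<chi> (ev p (c - d)) * \<chi> (- ev q (c' - d)))
    = (\<Sum>p\<in>index. \<Sum>d\<in>C. \<Sum>q\<in>index. \<chi> (ev p (c - d)) * \<chi> (- ev q (c' - d)))"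
    by (rule sum.swap)
  also have "\<dots> = (\<Sum>p\<in>index. \<Sum>q\<in>index. \<Sum>d\<in>C. \<chi> (ev p (c - d)) * \<chi> (- ev q (c' - d)))"
    by (rule sum.cong[OF refl]) (rule sum.swap)
  also have "\<dots> = of_nat m * of_nat (card C) * (\<Sum>p\<in>index. \<chi> (ev p (c - c')))"
    by (simp add: inner sum_distrib_left)
  also have "(\<Sum>p\<in>index. \<chi> (ev p (c - c'))) = ?u * of_real (F (c - c'))"
    using one_in_ring_units by (subst F_expand[OF code_diff[OF c]]) auto
  finally have "complex_of_real (\<Sum>d\<in>C. F (c - d) * F (c' - d))
    = complex_of_real (real m * real (card C) / real (card U) * F (c - c'))"
    using one_in_ring_units by (auto simp: field_simps)
  then show ?thesis by (simp only: of_real_eq_iff)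
qed

text \<open>
  Modularity enters here: the vectors \<open>g\<^sub>j u\<close>, over all columns \<open>g\<^sub>j\<close> and units \<open>u\<close>,
  all occur with the same multiplicity \<open>r |U|\<close>.
\<close>

lemma modular_multiplicity:
  assumes "modular_code n C"
  shows "\<exists>m. \<forall>p\<in>index. card {q \<in> index. \<forall>d\<in>C. ev q d = ev p d} = m"
proof -
  obtain r where "modular_of_index n C r"
    using assms unfolding modular_code_def by blast
  then obtain k G where nz: "no_zero_coordinate n C" and gen: "generates_code k n G C"
    and mult: "\<And>g. g \<in> carrier_vec k \<Longrightarrow> g \<noteq> 0\<^sub>v k \<Longrightarrow>
           point_mult G (cyclic_submodule g) = 0 \<or>
           of_nat (point_mult G (cyclic_submodule g)) = r * of_nat (card (unit_orbit g))"
    unfolding modular_of_index_def by blast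
  have G: "G \<in> carrier_mat k n" and C: "C = {row_times_mat x G | x. x \<in> carrier_vec k}"
    using gen unfolding generates_code_def by auto
  have colG: "col G j \<in> carrier_vec k" for j
    using G by auto
  have ev_row: "ev (j, v) (row_times_mat x G) = x \<bullet> right_smult_vec (col G j) v"
    if "j < n" for j v x
    using that G by (simp add: ev_def row_times_mat_def scalar_prod_def sum_distrib_right mult.assoc)
  have same: "(\<forall>d\<in>C. ev (j, v) d = ev (i, u) d) \<longleftrightarrow>
      right_smult_vec (col G j) v = right_smult_vec (col G i) u" if ij: "i < n" "j < n" for i j u v
  proof
    assume eq: "\<forall>d\<in>C. ev (j, v) d = ev (i, u) d"
    show "right_smult_vec (col G j) v = right_smult_vec (col G i) u"
    proof (rule eq_vecI)
      fix l assume "l < dim_vec (right_smult_vec (col G i) u)"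
      then have l: "l < k" using G by simp
      \<comment> \<open>Encoding the unit vectors reads off the entries of a column, so a functional
        on \<open>C\<close> determines its column vector.\<close>
      have "row_times_mat (unit_vec k l) G \<in> C"
        unfolding C by auto
      then have "unit_vec k l \<bullet> right_smult_vec (col G j) v = unit_vec k l \<bullet> right_smult_vec (col G i) u"
        using eq ev_row ij by metis
      moreover have "right_smult_vec (col G j) v \<in> carrier_vec k" for j v
        by (rule carrier_vecI) (use G in simp)
      ultimately show "right_smult_vec (col G j) v $ l = right_smult_vec (col G i) u $ l"
        using l by (simp only: scalar_prod_left_unit)
    qed simp
  next
    assume "right_smult_vec (col G j) v = right_smult_vec (col G i) u"
    then show "\<forall>d\<in>C. ev (j, v) d = ev (i, u) d"
      using ij by (auto simp: C ev_row)
  qed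
  \<comment> \<open>The pairs \<open>(j, v)\<close> with the functional of \<open>(i, u)\<close>
    have \<open>j\<close> among the columns spanning the point of column \<open>i\<close>, and for
    each such \<open>j\<close> as many \<open>v\<close> as the stabilizer has elements. Modularity
    gives \<open>r\<close> times the orbit size for the former; orbit size times stabilizer size is
    the number of units.\<close>
  have count: "of_nat (card {q \<in> index. \<forall>d\<in>C. ev q d = ev p d}) = r * of_nat (card U)"
    if p: "p \<in> index" for p
  proof -
    obtain i u where iu: "p = (i, u)" "i < n" "u \<in> U"
      using p by (auto simp: index_def)
    let ?g = "col G i"
    define J where "J = {j. j < n \<and> cyclic_submodule (col G j) = cyclic_submodule ?g}"
    let ?s = "card {v \<in> U. right_smult_vec ?g v = ?g}"
    have J: "point_mult G (cyclic_submodule ?g) = card J"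
      using G by (simp add: point_mult_def J_def)
    have "{q \<in> index. \<forall>d\<in>C. ev q d = ev p d}
      = (SIGMA j:J. {v \<in> U. right_smult_vec (col G j) v = right_smult_vec ?g u})"
    proof (intro equalityI subsetI)
      fix q assume "q \<in> {q \<in> index. \<forall>d\<in>C. ev q d = ev p d}"
      then obtain j v where jv: "q = (j, v)" "j < n" "v \<in> U" "\<forall>d\<in>C. ev (j, v) d = ev (i, u) d"
        using iu by (auto simp: index_def)
      then have eq: "right_smult_vec (col G j) v = right_smult_vec ?g u"
        using same iu by blast
      then have "cyclic_submodule (col G j) = cyclic_submodule ?g"
        using jv iu cyclic_submodule_unit by metis
      then show "q \<in> (SIGMA j:J. {v \<in> U. right_smult_vec (col G j) v = right_smult_vec ?g u})"
        using jv eq by (simp add: J_def)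
    next
      fix q assume "q \<in> (SIGMA j:J. {v \<in> U. right_smult_vec (col G j) v = right_smult_vec ?g u})"
      then obtain j v where jv: "q = (j, v)" "j < n" "v \<in> U"
        "right_smult_vec (col G j) v = right_smult_vec ?g u"
        by (auto simp: J_def)
      then have "\<forall>d\<in>C. ev q d = ev p d"
        using same iu by blast
      then show "q \<in> {q \<in> index. \<forall>d\<in>C. ev q d = ev p d}"
        using jv by (simp add: index_def)
    qed
    moreover have "card {v \<in> U. right_smult_vec (col G j) v = right_smult_vec ?g u} = ?s"
      if j: "j \<in> J" for j
    proof -
      have cyc: "cyclic_submodule (col G j) = cyclic_submodule ?g"
        using j by (simp add: J_def)
      obtain a where a: "a \<in> U" "?g = right_smult_vec (col G j) a"
        using cyclic_submodule_eq_imp_unit[OF cyc] by blast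
      \<comment> \<open>Column \<open>i\<close> is \<open>a\<close> times column \<open>j\<close>
        for a unit \<open>a\<close>, so the set in question is a fibre of the action on column
        \<open>j\<close>; equal orbits then give stabilizers of equal size.\<close>
      have "right_smult_vec ?g u = right_smult_vec (col G j) (a * u)"
        using a right_smult_vec_assoc by metis
      then have 1: "card {v \<in> U. right_smult_vec (col G j) v = right_smult_vec ?g u}
          = card {v \<in> U. right_smult_vec (col G j) v = col G j}"
        using card_unit_stabilizer(2)[OF ring_units_mult[OF a(1) iu(3)], of "col G j"] by simp
      have orbits: "unit_orbit (col G j) = unit_orbit ?g"
      proof -
        obtain b where b: "b \<in> U" "col G j = right_smult_vec ?g b"
          using cyclic_submodule_eq_imp_unit[OF cyc[symmetric]] by blast
        have sub: "unit_orbit (right_smult_vec g s) \<subseteq> unit_orbit g" if "s \<in> U" for g s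
          unfolding unit_orbit_def using ring_units_mult[OF that] right_smult_vec_assoc by blast
        show ?thesis
          using sub[OF a(1), of "col G j"] sub[OF b(1), of ?g]
          unfolding a(2)[symmetric] b(2)[symmetric] by (rule equalityI[rotated])
      qed
      have "card (unit_orbit ?g) > 0"
        using card_unit_stabilizer(1)[of ?g] card_units_pos by (metis gr0I mult_is_0)
      then show ?thesis
        using 1 card_unit_stabilizer(1)[of ?g] card_unit_stabilizer(1)[of "col G j"] orbits by simp
    qed
    moreover have "finite J" by (simp add: J_def)
    ultimately have "card {q \<in> index. \<forall>d\<in>C. ev q d = ev p d} = card J * ?s"
      by (simp add: card_SigmaI)
    moreover have "of_nat (card J) = r * of_nat (card (unit_orbit ?g))"
    proof -
      \<comment> \<open>A column belonging to a nonzero coordinate is nonzero and so spans a point.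
        Its multiplicity is positive since \<open>i\<close> itself lies in \<open>J\<close>, which
        leaves only the second alternative of modularity.\<close>
      obtain d where d: "d \<in> C" "d $ i \<noteq> 0"
        using nz iu unfolding no_zero_coordinate_def by blast
      then obtain x where x: "x \<in> carrier_vec k" "x \<bullet> ?g \<noteq> 0"
        using iu G unfolding C row_times_mat_def by auto
      have "?g \<noteq> 0\<^sub>v k" using x by auto
      moreover have "card J \<noteq> 0"
        using iu \<open>finite J\<close> by (auto simp: J_def)
      ultimately show ?thesis
        using mult[OF colG[of i]] J by simp
    qed
    ultimately show ?thesis
      using card_unit_stabilizer(1)[of ?g] by simp
  qed
  show ?thesis
  proof (cases "index = {}")
    case False
    then obtain p0 where p0: "p0 \<in> index" by blast
    have "card {q \<in> index. \<forall>d\<in>C. ev q d = ev p d} = card {q \<in> index. \<forall>d\<in>C. ev q d = ev p0 d}"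
      if p: "p \<in> index" for p
      using trans[OF count[OF p] count[OF p0, symmetric]] by (simp only: of_nat_eq_iff)
    then show ?thesis by blast
  qed simp
qed

end

section \<open>The graph of a modular two-weight code\<close>

context frobenius_code
begin

section \<open>The weight-zero subcode and its cosets\<close>

lemma F_zero: "F (0\<^sub>v n) = real n"
proof -
  have "hom_weight \<chi> 0 = 0"
    using units_nonempty by (simp add: hom_weight_def char_zero)
  then show ?thesis
    by (simp add: F_def hom_weight_vec_def)
qed

text \<open>Up to the factor \<open>card U\<close>, the weight is a sum of the nonnegative terms
  \<open>1 - Re (\<chi> (ev p x))\<close>. It vanishes only if all these characters take the value
  1, so \<open>C0\<close> is an intersection of kernels; the closure properties below rest on
  this.\<close>

lemma C0_iff: "x \<in> C0 \<longleftrightarrow> x \<in> C \<and> (\<forall>p\<in>index. \<chi> (ev p x) = 1)"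
proof (cases "x \<in> C")
  case True
  have card: "card index = n * card U"
    by (simp add: index_def card_cartesian_product)
  have "F x = Re (complex_of_real (F x))" by simp
  also have "\<dots> = (\<Sum>p\<in>index. Re (\<chi> (ev p x))) / real (card U)"
    by (subst F_expand[OF True]) simp
  finally have "w x * real (card U) = real (card index) - (\<Sum>p\<in>index. Re (\<chi> (ev p x)))"
    using units_nonempty by (simp add: F_def card field_simps)
  then have weight: "w x * real (card U) = (\<Sum>p\<in>index. 1 - Re (\<chi> (ev p x)))"
    by (simp add: sum_subtractf)
  have norm: "cmod (\<chi> y) = 1" for y
    by (rule additive_char_norm[OF additive])
  have "Re (\<chi> y) = 1 \<longleftrightarrow> \<chi> y = 1" for y
    using norm[of y] cmod_power2[of "\<chi> y"] by (auto simp: complex_eq_iff)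
  moreover have "Re (\<chi> y) \<le> 1" for y
    using complex_Re_le_cmod[of "\<chi> y"] norm[of y] by simp
  then have "(\<Sum>p\<in>index. 1 - Re (\<chi> (ev p x))) = 0 \<longleftrightarrow> (\<forall>p\<in>index. 1 - Re (\<chi> (ev p x)) = 0)"
    by (intro sum_nonneg_eq_0_iff finite_index) simp
  ultimately have "w x * real (card U) = 0 \<longleftrightarrow> (\<forall>p\<in>index. \<chi> (ev p x) = 1)"
    unfolding weight by simp
  then show ?thesis
    using True units_nonempty by (simp add: weight_zero_subcode_def)
qed (simp add: weight_zero_subcode_def)

lemma C0_code: "x \<in> C0 \<Longrightarrow> x \<in> C"
  by (simp add: C0_iff)

lemma C0_zero: "0\<^sub>v n \<in> C0"
  using code_zero by (auto simp: C0_iff index_def ev_def char_zero)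

lemma C0_diff: "x - y \<in> C0" if "x \<in> C0" "y \<in> C0"
proof -
  have "\<chi> (ev p (x - y)) = 1" if p: "p \<in> index" for p
  proof -
    have "\<chi> (ev p x) = 1" "\<chi> (ev p y) = 1"
      using \<open>x \<in> C0\<close> \<open>y \<in> C0\<close> p by (auto simp: C0_iff)
    moreover have "ev p (x - y) = ev p x + - ev p y"
      using ev_diff[OF C0_code[OF \<open>x \<in> C0\<close>] C0_code[OF \<open>y \<in> C0\<close>] p] by simp
    ultimately show ?thesis
      by (simp only: char_add char_minus) simp
  qed
  then show ?thesis
    using that code_diff[OF C0_code C0_code] by (simp add: C0_iff)
qed

lemma C0_add: "x + y \<in> C0" if "x \<in> C0" "y \<in> C0"
proof -
  have "x + y = x - (0\<^sub>v n - y)"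
    by (rule eq_vecI) (simp_all add: code_dim[OF C0_code] that)
  then show ?thesis
    using that C0_zero by (simp only: C0_diff)
qed

lemma finite_C0: "finite C0"
  by (rule finite_subset[OF _ finite_code]) (auto dest: C0_code)

lemma card_C0_pos: "card C0 > 0"
  using C0_zero finite_C0 by (auto simp: card_gt_0_iff)

lemma F_add_C0: "F (x + z) = F x" if "x \<in> C" "z \<in> C0"
proof -
  have z: "z \<in> C" using that C0_code by blast
  have "\<chi> (ev p (x + z)) = \<chi> (ev p x)" if p: "p \<in> index" for p
  proof -
    have "\<chi> (ev p z) = 1" using \<open>z \<in> C0\<close> p by (simp add: C0_iff)
    then show ?thesis using ev_add[OF \<open>x \<in> C\<close> z p] by (simp add: char_add)
  qed
  then have "complex_of_real (F (x + z)) = complex_of_real (F x)"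
    unfolding F_expand[OF code_add[OF \<open>x \<in> C\<close> z]] F_expand[OF \<open>x \<in> C\<close>] by simp
  then show ?thesis by (simp only: of_real_eq_iff)
qed

text \<open>Evaluates a convolution with the indicator function of \<open>C0\<close>: the
  contributing \<open>d\<close> are the \<open>c - z\<close> with \<open>z \<in> C0\<close>, and
  there \<open>c' - d = (c' - c) + z\<close>.\<close>

lemma sum_C0_translate:
  fixes h :: "'a vec \<Rightarrow> real"
  assumes c: "c \<in> C" "c' \<in> C" and h: "\<And>x z. x \<in> C \<Longrightarrow> z \<in> C0 \<Longrightarrow> h (x + z) = h x"
  shows "(\<Sum>d\<in>C. if c - d \<in> C0 then h (c' - d) else 0) = real (card C0) * h (c' - c)"
proof -
  have cc: "c - (c - x) = x" if "x \<in> C" for x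
    by (rule eq_vecI) (simp_all add: code_dim that c)
  have "(\<Sum>d\<in>C. if c - d \<in> C0 then h (c' - d) else 0) = (\<Sum>d\<in>{d \<in> C. c - d \<in> C0}. h (c' - d))"
    by (rule sum.inter_filter[OF finite_code, symmetric])
  also have "\<dots> = (\<Sum>z\<in>C0. h (c' - (c - z)))"
  proof (rule sum.reindex_bij_betw[symmetric])
    show "bij_betw (\<lambda>z. c - z) C0 {d \<in> C. c - d \<in> C0}"
      by (rule bij_betwI[where g = "\<lambda>d. c - d"]) (auto simp: cc C0_code intro: code_diff c C0_code)
  qed
  also have "\<dots> = (\<Sum>z\<in>C0. h (c' - c))"
  proof (rule sum.cong[OF refl])
    fix z assume z: "z \<in> C0"
    have "c' - (c - z) = (c' - c) + z"
      by (rule eq_vecI) (simp_all add: code_dim c C0_code z)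
    then show "h (c' - (c - z)) = h (c' - c)"
      using h[OF code_diff[OF c(2,1)] z] by simp
  qed
  finally show ?thesis by simp
qed

lemma code_coset_eq_iff:
  assumes "c \<in> C" "d \<in> C"
  shows "code_coset \<chi> C c = code_coset \<chi> C d \<longleftrightarrow> c - d \<in> C0"
proof
  assume eq: "code_coset \<chi> C c = code_coset \<chi> C d"
  have "c = c + 0\<^sub>v n"
    using assms code_carrier by auto
  then have "c \<in> code_coset \<chi> C c"
    unfolding code_coset_def using C0_zero by (rule image_eqI)
  then obtain z where z: "z \<in> C0" "c = d + z"
    unfolding eq unfolding code_coset_def by blast
  have "d + z - d = z"
    by (rule eq_vecI) (simp_all add: code_dim C0_code z(1) assms)
  then show "c - d \<in> C0" using z by simp
next
  assume z: "c - d \<in> C0"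
  have "c + x \<in> code_coset \<chi> C d" if "x \<in> C0" for x
  proof -
    have "c + x = d + ((c - d) + x)"
      by (rule eq_vecI) (simp_all add: code_dim C0_code that assms)
    then show ?thesis
      unfolding code_coset_def using C0_add[OF z that] by (rule image_eqI)
  qed
  moreover have "d + x \<in> code_coset \<chi> C c" if "x \<in> C0" for x
  proof -
    have "d + x = c + (x - (c - d))"
      by (rule eq_vecI) (simp_all add: code_dim C0_code that assms)
    then show ?thesis
      unfolding code_coset_def using C0_diff[OF that z] by (rule image_eqI)
  qed
  ultimately show "code_coset \<chi> C c = code_coset \<chi> C d"
    unfolding code_coset_def by blast
qed

text \<open>A set saturated under \<open>C0\<close> is the disjoint union of its cosets. This
  converts vertex counts in the graph into codeword counts in \<open>C\<close>.\<close>

lemma card_code_coset_image: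
  assumes A: "A \<subseteq> C" and sat: "\<And>x z. x \<in> A \<Longrightarrow> z \<in> C0 \<Longrightarrow> x + z \<in> A"
  shows "card A = card (code_coset \<chi> C ` A) * card C0"
proof -
  have "\<Union> (code_coset \<chi> C ` A) = A"
  proof
    show "\<Union> (code_coset \<chi> C ` A) \<subseteq> A"
      using sat by (auto simp: code_coset_def)
    show "A \<subseteq> \<Union> (code_coset \<chi> C ` A)"
    proof
      fix x assume x: "x \<in> A"
      have "x = x + 0\<^sub>v n"
        using x A code_carrier by auto
      then have "x \<in> code_coset \<chi> C x"
        unfolding code_coset_def using C0_zero by (rule image_eqI)
      then show "x \<in> \<Union> (code_coset \<chi> C ` A)" using x by blast
    qed
  qed
  moreover have "card C0 * card (code_coset \<chi> C ` A) = card (\<Union> (code_coset \<chi> C ` A))"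
  proof (rule card_partition)
    show fin: "finite (code_coset \<chi> C ` A)" "finite (\<Union> (code_coset \<chi> C ` A))"
      using A finite_code finite_subset \<open>\<Union> (code_coset \<chi> C ` A) = A\<close> by auto
    show "card c = card C0" if c: "c \<in> code_coset \<chi> C ` A" for c
    proof -
      obtain x where x: "x \<in> A" "c = code_coset \<chi> C x" using c by blast
      have "inj_on (\<lambda>z. x + z) C0"
      proof (rule inj_on_inverseI)
        fix z assume z: "z \<in> C0"
        show "(x + z) - x = z"
          by (rule eq_vecI) (use x A z in \<open>auto simp: code_dim C0_code\<close>)
      qed
      then show ?thesis
        unfolding x code_coset_def by (rule card_image)
    qed
    show "c \<inter> d = {}" if cd: "c \<in> code_coset \<chi> C ` A" "d \<in> code_coset \<chi> C ` A" "c \<noteq> d" for c d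
    proof (rule ccontr)
      assume "c \<inter> d \<noteq> {}"
      then obtain v where v: "v \<in> c" "v \<in> d" by blast
      obtain x y where xy: "x \<in> C" "c = code_coset \<chi> C x" "y \<in> C" "d = code_coset \<chi> C y"
        using cd A by blast
      then obtain s t where st: "s \<in> C0" "v = x + s" "t \<in> C0" "v = y + t"
        using v unfolding code_coset_def by blast
      have "x - y = (x + s - s) - y"
        by (rule eq_vecI) (simp_all add: code_dim C0_code xy st(1))
      also have "\<dots> = (y + t - s) - y" by (simp only: trans[OF st(2)[symmetric] st(4)])
      also have "\<dots> = t - s"
        by (rule eq_vecI) (simp_all add: code_dim C0_code xy st(1,3))
      finally have "x - y \<in> C0" using C0_diff[OF st(3,1)] by simp
      then show False using code_coset_eq_iff xy cd(3) by blast
    qed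
  qed
  ultimately show ?thesis by (simp add: mult.commute)
qed

section \<open>Adjacency and neighbour counts in terms of codewords\<close>

lemma weight_diff_cong:
  assumes "c \<in> C" "d \<in> C" "c' \<in> C" "d' \<in> C" "c - c' \<in> C0" "d - d' \<in> C0"
  shows "w (c - d) = w (c' - d')"
proof -
  have "c - d = (c' - d') + ((c - c') - (d - d'))"
    by (rule eq_vecI) (simp_all add: code_dim assms)
  then have "F (c - d) = F (c' - d')"
    using F_add_C0[OF code_diff[OF assms(3,4)] C0_diff[OF assms(5,6)]] by (simp only:)
  then show ?thesis by (simp add: F_def)
qed

lemma code_graph_arc_iff:
  assumes "c \<in> C" "d \<in> C"
  shows "(code_coset \<chi> C c, code_coset \<chi> C d) \<in> parcs (code_graph \<chi> C w1) \<longleftrightarrow> w (c - d) = w1"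
proof
  assume "(code_coset \<chi> C c, code_coset \<chi> C d) \<in> parcs (code_graph \<chi> C w1)"
  then obtain c' d' where *: "c' \<in> C" "d' \<in> C" "w (c' - d') = w1"
    "code_coset \<chi> C c = code_coset \<chi> C c'" "code_coset \<chi> C d = code_coset \<chi> C d'"
    by (auto simp: code_graph_def)
  then show "w (c - d) = w1"
    using weight_diff_cong[of c d c' d'] code_coset_eq_iff assms by simp
qed (use assms in \<open>auto simp: code_graph_def\<close>)

lemma neighbours_code_graph:
  assumes "c \<in> C"
  shows "neighbours (code_graph \<chi> C w1) (code_coset \<chi> C c) = code_coset \<chi> C ` {d \<in> C. w (c - d) = w1}"
proof -
  have "neighbours (code_graph \<chi> C w1) (code_coset \<chi> C c)
    = {v \<in> code_coset \<chi> C ` C. (code_coset \<chi> C c, v) \<in> parcs (code_graph \<chi> C w1)}"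
    by (simp add: neighbours_def code_graph_def)
  also have "\<dots> = code_coset \<chi> C ` {d \<in> C. w (c - d) = w1}"
    using code_graph_arc_iff[OF assms] by blast
  finally show ?thesis .
qed

lemma common_neighbours_code_graph:
  assumes "c \<in> C" "c' \<in> C"
  shows "neighbours (code_graph \<chi> C w1) (code_coset \<chi> C c) \<inter> neighbours (code_graph \<chi> C w1) (code_coset \<chi> C c')
    = code_coset \<chi> C ` {d \<in> C. w (c - d) = w1 \<and> w (c' - d) = w1}"
proof -
  have "neighbours (code_graph \<chi> C w1) (code_coset \<chi> C c) \<inter> neighbours (code_graph \<chi> C w1) (code_coset \<chi> C c')
    = {v \<in> code_coset \<chi> C ` C. (code_coset \<chi> C c, v) \<in> parcs (code_graph \<chi> C w1) \<and>
        (code_coset \<chi> C c', v) \<in> parcs (code_graph \<chi> C w1)}"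
    by (auto simp: neighbours_def code_graph_def)
  also have "\<dots> = code_coset \<chi> C ` {d \<in> C. w (c - d) = w1 \<and> w (c' - d) = w1}"
    using code_graph_arc_iff[OF assms(1)] code_graph_arc_iff[OF assms(2)] by blast
  finally show ?thesis .
qed

lemma weight_diff_add_C0:
  assumes "c \<in> C" "d \<in> C" "z \<in> C0"
  shows "w (c - (d + z)) = w (c - d)"
proof (rule weight_diff_cong)
  show "c - c \<in> C0" using C0_zero assms code_carrier by auto
  have "d + z - d = z"
    by (rule eq_vecI) (simp_all add: code_dim assms C0_code)
  then show "d + z - d \<in> C0" using assms by simp
qed (use assms C0_code code_add in auto)

lemma card_neighbours_code_graph:
  assumes "c \<in> C"
  shows "card (neighbours (code_graph \<chi> C w1) (code_coset \<chi> C c)) * card C0 = card {d \<in> C. w (c - d) = w1}"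
  unfolding neighbours_code_graph[OF assms]
  by (rule card_code_coset_image[symmetric]) (auto simp: weight_diff_add_C0 assms intro: code_add C0_code)

lemma card_common_neighbours_code_graph:
  assumes "c \<in> C" "c' \<in> C"
  shows "card (neighbours (code_graph \<chi> C w1) (code_coset \<chi> C c) \<inter> neighbours (code_graph \<chi> C w1) (code_coset \<chi> C c'))
    * card C0 = card {d \<in> C. w (c - d) = w1 \<and> w (c' - d) = w1}"
  unfolding common_neighbours_code_graph[OF assms]
  by (rule card_code_coset_image[symmetric]) (auto simp: weight_diff_add_C0 assms intro: code_add C0_code)

end

text \<open>\<open>K1\<close> is the degree count and \<open>K2\<close> the count of common
  neighbours of a vertex with itself. The constant \<open>r\<close> from the convolution of
  \<open>F\<close> is not known explicitly; the two equations determine \<open>r * n\<close>, which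
  eliminates it from \<open>l\<close> and \<open>m\<close>.\<close>

lemma srg_parameter_identities:
  fixes n :: real
  assumes n: "n \<noteq> 0" and w: "w1 \<noteq> w2"
    and K1: "(w2 - w1) * K = - (n - w2) * N - w2"
    and K2: "(w2 - w1)\<^sup>2 * K = r * n + N * (n - w2)\<^sup>2 - 2 * w2 * n + 2 * (n - w2) * w2 + w2\<^sup>2"
  shows "(w2 - w1)\<^sup>2 * l = (r - 2 * w2) * (n - w1) + N * (n - w2)\<^sup>2 + 2 * (n - w2) * w2 \<Longrightarrow>
      l = (K * (w1\<^sup>2 / n - 2 * w1) + w2 * (K - 1)) / (w2 - w1)"
    and "(w2 - w1)\<^sup>2 * m = (r - 2 * w2) * (n - w2) + N * (n - w2)\<^sup>2 + 2 * (n - w2) * w2 \<Longrightarrow>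
      m = (K * (w1 * w2 / n - w1 - w2) + w2 * K) / (w2 - w1)"
proof -
  let ?a = "w2 - w1"
  have a: "?a \<noteq> 0" using w by simp
  have bN: "(n - w2) * N = - (?a * K) - w2" using K1 by (simp add: algebra_simps)
  then have "(n - w2) * ((n - w2) * N) = (n - w2) * (- (?a * K) - w2)" by simp
  then have rn: "r * n = ?a * K * (n - w1) + w2 * n"
    using K2 by (simp add: algebra_simps power2_eq_square)
  show "l = (K * (w1\<^sup>2 / n - 2 * w1) + w2 * (K - 1)) / ?a"
    if l: "?a\<^sup>2 * l = (r - 2 * w2) * (n - w1) + N * (n - w2)\<^sup>2 + 2 * (n - w2) * w2"
  proof -
    \<comment> \<open>The factor \<open>n\<close> makes \<open>r\<close> and \<open>N\<close> appear
      only as \<open>r * n\<close> and \<open>(n - w2) * N\<close>, for which \<open>rn\<close> and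
      \<open>bN\<close> can be substituted.\<close>
    have "?a * (?a * (l * n)) = (?a\<^sup>2 * l) * n"
      by (simp add: power2_eq_square)
    also have "\<dots> = (r * n - 2 * w2 * n) * (n - w1) + ((n - w2) * N) * (n - w2) * n + 2 * (n - w2) * w2 * n"
      unfolding l by (simp add: algebra_simps power2_eq_square)
    also have "\<dots> = ?a * (K * (w1\<^sup>2 - 2 * w1 * n) + w2 * (K - 1) * n)"
      unfolding rn bN by (simp add: algebra_simps power2_eq_square)
    finally have "?a * (l * n) = K * (w1\<^sup>2 - 2 * w1 * n) + w2 * (K - 1) * n"
      by (rule mult_left_cancel[OF a, THEN iffD1])
    then show ?thesis using a n by (simp add: field_simps)
  qed
  show "m = (K * (w1 * w2 / n - w1 - w2) + w2 * K) / ?a"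
    if m: "?a\<^sup>2 * m = (r - 2 * w2) * (n - w2) + N * (n - w2)\<^sup>2 + 2 * (n - w2) * w2"
  proof -
    have "?a * (?a * (m * n)) = (?a\<^sup>2 * m) * n"
      by (simp add: power2_eq_square)
    also have "\<dots> = (r * n - 2 * w2 * n) * (n - w2) + ((n - w2) * N) * (n - w2) * n + 2 * (n - w2) * w2 * n"
      unfolding m by (simp add: algebra_simps power2_eq_square)
    also have "\<dots> = ?a * (K * (w1 * w2 - w1 * n - w2 * n) + w2 * K * n)"
      unfolding rn bN by (simp add: algebra_simps power2_eq_square)
    finally have "?a * (m * n) = K * (w1 * w2 - w1 * n - w2 * n) + w2 * K * n"
      by (rule mult_left_cancel[OF a, THEN iffD1])
    then show ?thesis using a n by (simp add: field_simps)
  qed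
qed

section \<open>Counting codewords of weight \<open>w1\<close> by convolution\<close>

locale modular_two_weight_code = frobenius_code +
  fixes w1 w2 :: real
  assumes two_weight: "two_weight_code \<chi> n C w1 w2" and modular: "modular_code n C"
begin

abbreviation \<Gamma> :: "'a vec set pair_pre_digraph" where "\<Gamma> \<equiv> code_graph \<chi> C w1"

lemma weights: "w1 < w2" "w ` C - {0} = {w1, w2}"
  using two_weight unfolding two_weight_code_def by auto

lemma weight_cases: "x \<in> C \<Longrightarrow> w x = 0 \<or> w x = w1 \<or> w x = w2"
  using weights(2) by blast

lemma weights_attained: "\<exists>x\<in>C. w x = w1" "\<exists>x\<in>C. w x = w2"
proof -
  have "w1 \<in> w ` C - {0}" "w2 \<in> w ` C - {0}"
    by (simp_all add: weights(2))
  then show "\<exists>x\<in>C. w x = w1" "\<exists>x\<in>C. w x = w2"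
    by auto
qed

lemma weight_nonneg: "w x \<ge> 0"
  unfolding hom_weight_vec_def by (intro sum_nonneg hom_weight_nonneg additive)

lemma w1_pos: "w1 > 0"
proof -
  have "w1 \<noteq> 0" using weights(2) by auto
  moreover have "w1 \<ge> 0" using weights_attained(1) weight_nonneg by auto
  ultimately show ?thesis by simp
qed

lemma n_pos: "n > 0"
proof (rule ccontr)
  assume "\<not> n > 0"
  then have "w x = 0" if "x \<in> C" for x
    using that by (simp add: hom_weight_vec_def code_dim)
  then show False using weights_attained(1) w1_pos by auto
qed

lemma nonzero_coordinates: "no_zero_coordinate n C"
  using modular unfolding modular_code_def modular_of_index_def by blast

text \<open>\<open>F - (n - w2)\<close> takes the values \<open>w2 - w1\<close> at weight
  \<open>w1\<close>, 0 at weight \<open>w2\<close> and \<open>w2\<close> at weight 0; the last term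
  corrects the value on \<open>C0\<close>.\<close>

lemma weight_indicator:
  assumes "x \<in> C"
  shows "(if w x = w1 then w2 - w1 else 0) = F x - (real n - w2) - w2 * (if x \<in> C0 then 1 else 0)"
  using weight_cases[OF assms] assms weights(1) w1_pos by (auto simp: F_def weight_zero_subcode_def)

lemma sum_C0: "c \<in> C \<Longrightarrow> (\<Sum>d\<in>C. if c - d \<in> C0 then 1 else 0) = real (card C0)"
  using sum_C0_translate[of c c "\<lambda>_. 1"] by simp

lemma card_weight_w1:
  assumes c: "c \<in> C"
  shows "(w2 - w1) * real (card {d \<in> C. w (c - d) = w1}) = - (real n - w2) * real (card C) - w2 * real (card C0)"
proof -
  have "(w2 - w1) * real (card {d \<in> C. w (c - d) = w1}) = (\<Sum>d\<in>C. if w (c - d) = w1 then w2 - w1 else 0)"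
    by (simp add: sum.inter_filter[OF finite_code, symmetric])
  also have "\<dots> = (\<Sum>d\<in>C. F (c - d) - (real n - w2) - w2 * (if c - d \<in> C0 then 1 else 0))"
    by (rule sum.cong[OF refl weight_indicator[OF code_diff[OF c]]])
  also have "\<dots> = (\<Sum>d\<in>C. F (c - d)) - real (card C) * (real n - w2) - w2 * (\<Sum>d\<in>C. if c - d \<in> C0 then 1 else 0)"
    by (simp add: sum_subtractf sum_distrib_left del: sum.delta)
  finally show ?thesis
    unfolding sum_F_translate[OF c nonzero_coordinates] sum_C0[OF c] by (simp add: algebra_simps)
qed

text \<open>The product of two translated indicators from \<open>weight_indicator\<close> is
  expanded and summed. The product of the two \<open>F\<close> terms gives a multiple of
  \<open>F (c - c')\<close>, terms linear in \<open>F\<close> sum to 0, and products with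
  \<open>C0\<close> indicators follow from \<open>sum_C0_translate\<close>. The factor \<rho> must
  not depend on \<open>c\<close> and \<open>c'\<close>; its value is recovered later from the
  degree.\<close>

lemma card_common_weight_w1:
  "\<exists>\<rho>. \<forall>c\<in>C. \<forall>c'\<in>C. (w2 - w1)\<^sup>2 * real (card {d \<in> C. w (c - d) = w1 \<and> w (c' - d) = w1})
    = (\<rho> - 2 * w2 * real (card C0)) * F (c - c') + real (card C) * (real n - w2)\<^sup>2
      + 2 * (real n - w2) * w2 * real (card C0) + w2\<^sup>2 * real (card C0) * (if c - c' \<in> C0 then 1 else 0)"
proof -
  obtain m where m: "\<And>p. p \<in> index \<Longrightarrow> card {q \<in> index. \<forall>d\<in>C. ev q d = ev p d} = m"
    using modular_multiplicity[OF modular] by blast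
  let ?\<rho> = "real m * real (card C) / real (card U)"
  let ?b = "real n - w2" and ?z = "real (card C0)"
  show ?thesis
  proof (intro exI[of _ ?\<rho>] ballI)
    fix c c' assume c: "c \<in> C" "c' \<in> C"
    define f where "f d = F (c - d)" for d
    define f' where "f' d = F (c' - d)" for d
    define e where "e d = (if c - d \<in> C0 then 1 else 0 :: real)" for d
    define e' where "e' d = (if c' - d \<in> C0 then 1 else 0 :: real)" for d
    have C0_swap: "x - y \<in> C0 \<longleftrightarrow> y - x \<in> C0" if "x \<in> C" "y \<in> C" for x y
      using weight_diff_commute[OF that] that code_diff by (simp add: weight_zero_subcode_def)
    have ff: "(\<Sum>d\<in>C. f d * f' d) = ?\<rho> * F (c - c')"
      unfolding f_def f'_def by (rule F_convolution[OF c m])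
    have f: "(\<Sum>d\<in>C. f d) = 0" "(\<Sum>d\<in>C. f' d) = 0"
      unfolding f_def f'_def using c by (simp_all add: sum_F_translate nonzero_coordinates)
    have e: "(\<Sum>d\<in>C. e d) = ?z" "(\<Sum>d\<in>C. e' d) = ?z"
      unfolding e_def e'_def using c by (simp_all only: sum_C0)
    have "(\<Sum>d\<in>C. e d * f' d) = (\<Sum>d\<in>C. if c - d \<in> C0 then F (c' - d) else 0)"
      by (rule sum.cong) (simp_all add: e_def f'_def)
    also have "\<dots> = ?z * F (c' - c)"
      by (rule sum_C0_translate[OF c]) (rule F_add_C0)
    finally have ef: "(\<Sum>d\<in>C. e d * f' d) = ?z * F (c - c')"
      using F_diff_commute[OF c] by simp
    have "(\<Sum>d\<in>C. e' d * f d) = (\<Sum>d\<in>C. if c' - d \<in> C0 then F (c - d) else 0)"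
      by (rule sum.cong) (simp_all add: e'_def f_def)
    also have "\<dots> = ?z * F (c - c')"
      by (rule sum_C0_translate[OF c(2,1)]) (rule F_add_C0)
    finally have ef': "(\<Sum>d\<in>C. e' d * f d) = ?z * F (c - c')" .
    have "(\<Sum>d\<in>C. e d * e' d) = (\<Sum>d\<in>C. if c - d \<in> C0 then (if c' - d \<in> C0 then 1 else 0) else 0)"
      by (rule sum.cong) (simp_all add: e_def e'_def)
    also have "\<dots> = ?z * (if c' - c \<in> C0 then 1 else 0)"
    proof (rule sum_C0_translate[OF c])
      fix x z assume x: "x \<in> C" "z \<in> C0"
      have "F (x + z) = F x" by (rule F_add_C0[OF x])
      then have "w (x + z) = w x" by (simp add: F_def)
      then have "x + z \<in> C0 \<longleftrightarrow> x \<in> C0"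
        using x(1) code_add[OF x(1) C0_code[OF x(2)]] by (simp add: weight_zero_subcode_def)
      then show "(if x + z \<in> C0 then 1 else 0 :: real) = (if x \<in> C0 then 1 else 0)" by simp
    qed
    finally have ee: "(\<Sum>d\<in>C. e d * e' d) = ?z * (if c - c' \<in> C0 then 1 else 0)"
      using C0_swap[OF c] by simp
    have "(w2 - w1)\<^sup>2 * real (card {d \<in> C. w (c - d) = w1 \<and> w (c' - d) = w1})
      = (\<Sum>d\<in>C. if w (c - d) = w1 \<and> w (c' - d) = w1 then (w2 - w1)\<^sup>2 else 0)"
      by (simp add: sum.inter_filter[OF finite_code, symmetric])
    also have "\<dots> = (\<Sum>d\<in>C. (if w (c - d) = w1 then w2 - w1 else 0) * (if w (c' - d) = w1 then w2 - w1 else 0))"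
      by (rule sum.cong) (auto simp: power2_eq_square)
    also have "\<dots> = (\<Sum>d\<in>C. (f d - ?b - w2 * e d) * (f' d - ?b - w2 * e' d))"
      unfolding f_def f'_def e_def e'_def using c
      by (intro sum.cong[OF refl] arg_cong2[of _ _ _ _ "(*)"] weight_indicator code_diff) auto
    also have "\<dots> = (\<Sum>d\<in>C. f d * f' d - ?b * f d - ?b * f' d - w2 * (e d * f' d) - w2 * (e' d * f d)
        + ?b * w2 * e d + ?b * w2 * e' d + w2\<^sup>2 * (e d * e' d) + ?b\<^sup>2)"
      by (rule sum.cong) (simp_all add: algebra_simps power2_eq_square)
    also have "\<dots> = (\<Sum>d\<in>C. f d * f' d) - ?b * (\<Sum>d\<in>C. f d) - ?b * (\<Sum>d\<in>C. f' d)
        - w2 * (\<Sum>d\<in>C. e d * f' d) - w2 * (\<Sum>d\<in>C. e' d * f d) + ?b * w2 * (\<Sum>d\<in>C. e d)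
        + ?b * w2 * (\<Sum>d\<in>C. e' d) + w2\<^sup>2 * (\<Sum>d\<in>C. e d * e' d) + real (card C) * ?b\<^sup>2"
      by (simp only: sum.distrib sum_subtractf sum_distrib_left sum_constant)
    also have "\<dots> = (?\<rho> - 2 * w2 * ?z) * F (c - c') + real (card C) * ?b\<^sup>2
      + 2 * ?b * w2 * ?z + w2\<^sup>2 * ?z * (if c - c' \<in> C0 then 1 else 0)"
      unfolding ff f e ef ef' ee by (simp add: algebra_simps)
    finally show "(w2 - w1)\<^sup>2 * real (card {d \<in> C. w (c - d) = w1 \<and> w (c' - d) = w1})
      = (?\<rho> - 2 * w2 * ?z) * F (c - c') + real (card C) * ?b\<^sup>2
      + 2 * ?b * w2 * ?z + w2\<^sup>2 * ?z * (if c - c' \<in> C0 then 1 else 0)" .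
  qed
qed

section \<open>The graph, its parameters and triviality\<close>

lemma pair_graph_code_graph: "pair_graph \<Gamma>"
proof unfold_locales
  show "fst e \<in> pverts \<Gamma>" "snd e \<in> pverts \<Gamma>" if "e \<in> parcs \<Gamma>" for e
    using that by (auto simp: code_graph_def)
  show fin: "finite (pverts \<Gamma>)"
    using finite_code by (simp add: code_graph_def)
  have "parcs \<Gamma> \<subseteq> pverts \<Gamma> \<times> pverts \<Gamma>"
    by (auto simp: code_graph_def)
  then show "finite (parcs \<Gamma>)"
    using fin finite_subset by blast
  show "fst e \<noteq> snd e" if e: "e \<in> parcs \<Gamma>" for e
  proof -
    obtain c d where cd: "e = (code_coset \<chi> C c, code_coset \<chi> C d)" "c \<in> C" "d \<in> C" "w (c - d) = w1"
      using e by (auto simp: code_graph_def)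
    then have "c - d \<notin> C0"
      using w1_pos by (auto simp: weight_zero_subcode_def)
    then show ?thesis using cd code_coset_eq_iff by simp
  qed
  have "(y, x) \<in> parcs \<Gamma>" if xy: "(x, y) \<in> parcs \<Gamma>" for x y
  proof -
    obtain c d where cd: "x = code_coset \<chi> C c" "y = code_coset \<chi> C d" "c \<in> C" "d \<in> C" "w (c - d) = w1"
      using xy by (auto simp: code_graph_def)
    then show ?thesis
      using weight_diff_commute[of c d] by (auto simp: code_graph_def)
  qed
  then show "symmetric \<Gamma>"
    by (auto simp: symmetric_def sym_def)
qed

lemma strongly_regular_code_graph:
  "\<exists>N K l m. strongly_regular \<Gamma> N K l m \<and>
     real N = real (card C) / real (card C0) \<and>
     real K = ((w2 - real n) * real N - w2) / (w2 - w1) \<and>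
     real l = (real K * (w1^2 / real n - 2 * w1) + w2 * (real K - 1)) / (w2 - w1) \<and>
     real m = (real K * (w1 * w2 / real n - w1 - w2) + w2 * real K) / (w2 - w1) \<and> K > 0"
proof -
  let ?z = "real (card C0)"
  let ?N = "card (pverts \<Gamma>)"
  let ?b = "real n - w2" and ?a = "w2 - w1"
  have z: "?z > 0" using card_C0_pos by simp
  have a: "?a \<noteq> 0" using weights(1) by simp
  have "card C = ?N * card C0"
    using card_code_coset_image[of C] code_add C0_code by (simp add: code_graph_def)
  then have N: "real (card C) = real ?N * ?z" by simp
  define nb where "nb c = card (neighbours \<Gamma> (code_coset \<chi> C c))" for c
  define cnb where "cnb c c' = card (neighbours \<Gamma> (code_coset \<chi> C c) \<inter> neighbours \<Gamma> (code_coset \<chi> C c'))" for c c'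
  have nb: "?a * real (nb c) = - ?b * real ?N - w2" if c: "c \<in> C" for c
  proof -
    have "real (card {d \<in> C. w (c - d) = w1}) = real (nb c) * ?z"
      using card_neighbours_code_graph[OF c, of w1] unfolding nb_def by (metis of_nat_mult)
    then have "(?a * real (nb c)) * ?z = (- ?b * real ?N - w2) * ?z"
      using card_weight_w1[OF c] N by (simp add: algebra_simps)
    then show ?thesis using z by simp
  qed
  obtain \<rho> where \<rho>: "\<And>c c'. c \<in> C \<Longrightarrow> c' \<in> C \<Longrightarrow>
     ?a\<^sup>2 * real (card {d \<in> C. w (c - d) = w1 \<and> w (c' - d) = w1})
    = (\<rho> - 2 * w2 * ?z) * F (c - c') + real (card C) * ?b\<^sup>2
      + 2 * ?b * w2 * ?z + w2\<^sup>2 * ?z * (if c - c' \<in> C0 then 1 else 0)"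
    using card_common_weight_w1 by blast
  \<comment> \<open>Division by \<open>card C0\<close> passes from codewords to vertices.\<close>
  define r where "r = \<rho> / ?z"
  have r: "\<rho> = r * ?z"
    using z by (simp add: r_def)
  have cnb: "?a\<^sup>2 * real (cnb c c') = (r - 2 * w2) * F (c - c') + real ?N * ?b\<^sup>2
      + 2 * ?b * w2 + w2\<^sup>2 * (if c - c' \<in> C0 then 1 else 0)" if c: "c \<in> C" "c' \<in> C" for c c'
  proof -
    have count: "real (card {d \<in> C. w (c - d) = w1 \<and> w (c' - d) = w1}) = real (cnb c c') * ?z"
      using card_common_neighbours_code_graph[OF c, of w1] unfolding cnb_def by (metis of_nat_mult)
    have "(?a\<^sup>2 * real (cnb c c')) * ?z = ((r - 2 * w2) * F (c - c') + real ?N * ?b\<^sup>2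
      + 2 * ?b * w2 + w2\<^sup>2 * (if c - c' \<in> C0 then 1 else 0)) * ?z"
      using \<rho>[OF c] unfolding count N r by (simp only: algebra_simps)
    then show ?thesis using z by simp
  qed
  obtain c1 where c1: "c1 \<in> C" "w c1 = w1" using weights_attained(1) by blast
  obtain c2 where c2: "c2 \<in> C" "w c2 = w2" using weights_attained(2) by blast
  let ?o = "0\<^sub>v n :: 'a vec"
  define K where "K = nb ?o"
  define l where "l = cnb c1 ?o"
  define m where "m = cnb c2 ?o"
  have K: "?a * real K = - ?b * real ?N - w2"
    unfolding K_def by (rule nb[OF code_zero])
  \<comment> \<open>The common neighbours of the zero coset with itself are its \<open>K\<close>
    neighbours; here \<open>F\<close> has the value \<open>n\<close> and the \<open>C0\<close>
    indicator is 1.\<close>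
  have K2: "?a\<^sup>2 * real K = r * real n + real ?N * ?b\<^sup>2 - 2 * w2 * real n + 2 * ?b * w2 + w2\<^sup>2"
  proof -
    have "cnb ?o ?o = K" by (simp add: cnb_def K_def nb_def)
    then show ?thesis
      using cnb[OF code_zero code_zero] C0_zero by (simp add: F_zero algebra_simps)
  qed
  have zero1: "c1 - ?o = c1" "c2 - ?o = c2"
    using c1 c2 code_carrier by auto
  have C0_w: "x \<notin> C0" if "w x \<noteq> 0" for x
    using that by (simp add: weight_zero_subcode_def)
  have regular: "nb c = K" if "c \<in> C" for c
  proof -
    have "?a * real (nb c) = ?a * real K" using nb[OF that] K by simp
    then show ?thesis using a by simp
  qed
  \<comment> \<open>Outside \<open>C0\<close> the count depends on the difference only through
    \<open>F\<close>, that is through its weight. Hence \<open>l\<close> and \<open>m\<close> may be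
    computed from the pairs \<open>(c1, 0)\<close> and \<open>(c2, 0)\<close>.\<close>
  have cnb_cong: "cnb c c' = cnb d d'"
    if "c \<in> C" "c' \<in> C" "d \<in> C" "d' \<in> C" "w (c - c') = w (d - d')" "w (c - c') \<noteq> 0" for c c' d d'
  proof -
    have "?a\<^sup>2 * real (cnb c c') = ?a\<^sup>2 * real (cnb d d')"
      using cnb[OF that(1,2)] cnb[OF that(3,4)] C0_w that(5,6) by (simp add: F_def)
    then show ?thesis using a by simp
  qed
  have w2_pos: "w2 > 0" using w1_pos weights(1) by simp
  have srg: "strongly_regular \<Gamma> ?N K l m"
    unfolding strongly_regular_def
  proof (intro conjI ballI impI)
    show "pair_graph \<Gamma>" by (rule pair_graph_code_graph)
    show "card (neighbours \<Gamma> v) = K" if "v \<in> pverts \<Gamma>" for v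
      using that regular by (auto simp: code_graph_def nb_def)
    fix u v assume "u \<in> pverts \<Gamma>" "v \<in> pverts \<Gamma>"
    then obtain c d where cd: "c \<in> C" "d \<in> C" "u = code_coset \<chi> C c" "v = code_coset \<chi> C d"
      by (auto simp: code_graph_def)
    show "card (neighbours \<Gamma> u \<inter> neighbours \<Gamma> v) = l" if "(u, v) \<in> parcs \<Gamma>"
    proof -
      have "w (c - d) = w1" using that cd code_graph_arc_iff by simp
      then have "cnb c d = cnb c1 ?o"
        using cnb_cong[OF cd(1,2) c1(1) code_zero] zero1 c1 w1_pos by simp
      then show ?thesis by (simp add: cnb_def l_def cd)
    qed
    show "card (neighbours \<Gamma> u \<inter> neighbours \<Gamma> v) = m" if "u \<noteq> v \<and> (u, v) \<notin> parcs \<Gamma>"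
    proof -
      have "w (c - d) \<noteq> w1" using that cd code_graph_arc_iff by simp
      moreover have "w (c - d) \<noteq> 0"
        using that cd code_coset_eq_iff code_diff by (simp add: weight_zero_subcode_def)
      ultimately have "w (c - d) = w2" using weight_cases[OF code_diff[OF cd(1,2)]] by simp
      then have "cnb c d = cnb c2 ?o"
        using cnb_cong[OF cd(1,2) c2(1) code_zero] zero1 c2 w2_pos by simp
      then show ?thesis by (simp add: cnb_def m_def cd)
    qed
  qed simp
  have l: "?a\<^sup>2 * real l = (r - 2 * w2) * (real n - w1) + real ?N * ?b\<^sup>2 + 2 * ?b * w2"
    using cnb[OF c1(1) code_zero] C0_w[of c1] w1_pos by (simp add: zero1 c1 F_def l_def)
  have m: "?a\<^sup>2 * real m = (r - 2 * w2) * (real n - w2) + real ?N * ?b\<^sup>2 + 2 * ?b * w2"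
    using cnb[OF c2(1) code_zero] C0_w[of c2] w2_pos by (simp add: zero1 c2 F_def m_def)
  have n: "real n \<noteq> 0" and w12: "w1 \<noteq> w2" using n_pos weights(1) by auto
  have "K > 0"
  proof -
    have "code_coset \<chi> C c1 \<in> neighbours \<Gamma> (code_coset \<chi> C ?o)"
      using neighbours_code_graph[OF code_zero, of w1] c1 weight_diff_commute[OF code_zero c1(1)]
      by (simp add: zero1)
    moreover have "finite (neighbours \<Gamma> (code_coset \<chi> C ?o))"
      using finite_code by (simp add: neighbours_def code_graph_def)
    ultimately show ?thesis
      by (auto simp: K_def nb_def card_gt_0_iff)
  qed
  moreover have "real ?N = real (card C) / ?z"
    using N z by simp
  moreover have "real K = ((w2 - real n) * real ?N - w2) / ?a"
    using K a by (simp add: field_simps)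
  ultimately show ?thesis
    using srg srg_parameter_identities(1)[OF n w12 K K2 l] srg_parameter_identities(2)[OF n w12 K K2 m]
    by blast
qed

lemma trivial_code_graph_iff: "trivial_srg \<Gamma> \<longleftrightarrow> w1 = real n"
proof -
  obtain N K l m where srg: "strongly_regular \<Gamma> N K l m"
    and K: "real K = ((w2 - real n) * real N - w2) / (w2 - w1)"
    and m: "real m = (real K * (w1 * w2 / real n - w1 - w2) + w2 * real K) / (w2 - w1)" and "K > 0"
    using strongly_regular_code_graph by blast
  have n: "real n > 0" and a: "w2 - w1 > 0" and w2: "w2 > 0"
    using n_pos weights(1) w1_pos by auto
  \<comment> \<open>This is the numerator of \<open>K\<close>, and the denominator is
    positive.\<close>
  have "(w2 - real n) * real N - w2 > 0"
    using K \<open>K > 0\<close> a by (metis of_nat_0_less_iff zero_less_divide_iff less_asym)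
  then have "(w2 - real n) * real N > 0" using w2 by simp
  then have w2n: "w2 > real n"
    by (simp add: zero_less_mult_iff)
  \<comment> \<open>The terms \<open>w2 * K\<close> cancel in the formula for \<open>m\<close>, so
    that the rest factors.\<close>
  have m': "real m * (real n * (w2 - w1)) = real K * (w1 * (w2 - real n))"
    unfolding m using n a by (simp add: field_simps)
  have "real K * (w1 * (w2 - real n)) > 0"
    using \<open>K > 0\<close> w1_pos w2n by simp
  then have m0: "m \<noteq> 0"
    unfolding m'[symmetric] by (rule contrapos_pn) simp
  have "m = K \<longleftrightarrow> real K * (real n * (w2 - w1)) = real K * (w1 * (w2 - real n))"
    unfolding m'[symmetric] using n a by auto
  also have "\<dots> \<longleftrightarrow> real n * (w2 - w1) = w1 * (w2 - real n)"
    using \<open>K > 0\<close> by simp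
  also have "\<dots> \<longleftrightarrow> real n * w2 = w1 * w2"
    by (simp add: algebra_simps)
  also have "\<dots> \<longleftrightarrow> w1 = real n"
    using w2 by auto
  finally have mK: "m = K \<longleftrightarrow> w1 = real n" .
  \<comment> \<open>A codeword of weight \<open>w2\<close> and the zero word give the distinct
    nonadjacent vertices required by the triviality criterion.\<close>
  obtain c2 where c2: "c2 \<in> C" "w c2 = w2" using weights_attained(2) by blast
  have c20: "c2 - 0\<^sub>v n = c2"
    using c2 code_carrier by auto
  have "code_coset \<chi> C c2 \<noteq> code_coset \<chi> C (0\<^sub>v n)"
    using code_coset_eq_iff[OF c2(1) code_zero] c20 c2 w2 by (simp add: weight_zero_subcode_def)
  moreover have "(code_coset \<chi> C c2, code_coset \<chi> C (0\<^sub>v n)) \<notin> parcs \<Gamma>"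
    using code_graph_arc_iff[OF c2(1) code_zero] c20 c2 weights(1) by simp
  moreover have "code_coset \<chi> C c2 \<in> pverts \<Gamma>" "code_coset \<chi> C (0\<^sub>v n) \<in> pverts \<Gamma>"
    using c2 code_zero by (simp_all add: code_graph_def)
  ultimately show ?thesis
    using strongly_regular_trivial_iff[OF srg] m0 mK by blast
qed

end

theorem theorem12:
  fixes \<chi> :: "'a::{ring_1, finite} \<Rightarrow> complex"
    and n :: nat and C :: "'a vec set" and w1 w2 :: real
  assumes "frobenius_ring TYPE('a)"
    and "generating_char \<chi>"
    and "two_weight_code \<chi> n C w1 w2"
    and "modular_code n C"
  shows "(\<exists>N K l m :: nat.
            strongly_regular (code_graph \<chi> C w1) N K l m \<and>
            real N = real (card C) / real (card (weight_zero_subcode \<chi> C)) \<and>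
            real K = ((w2 - real n) * real N - w2) / (w2 - w1) \<and>
            real l = (real K * (w1^2 / real n - 2 * w1) + w2 * (real K - 1)) / (w2 - w1) \<and>
            real m = (real K * (w1 * w2 / real n - w1 - w2) + w2 * real K) / (w2 - w1))
         \<and> (trivial_srg (code_graph \<chi> C w1) \<longleftrightarrow> w1 = real n)"
proof -
  interpret modular_two_weight_code \<chi> n C w1 w2
    by unfold_locales (use assms in \<open>simp_all add: two_weight_code_def\<close>)
  show ?thesis
    using strongly_regular_code_graph trivial_code_graph_iff by blast
qed

end
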